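(* Let $n\ge2$ and let $\Omega\subset\mathbb{R}^n$ be a bounded open set of class $C^2$ with outer unit normal $\nu$. Choose $\bar x\in\Omega$ and define $R_1=\min_{x\in\partial\Omega}|x-\bar x|$ and $R_2=\max_{x\in\partial\Omega}|x-\bar x|$. For $x\in\partial\Omega$ let $H(x)$ denote the mean curvature of $\partial\Omega$ at $x$. Let $q:[R_1,R_2]\times(0,\infty)\to(0,\infty)$ be a positive function such that 1. $q(r,h)$ is monotone non-decreasing in $h$ for every $r\in[R_1,R_2]$; 2. the ratio $\dfrac{q(r,1/r)}{r}$ is strictly increasing in $r\in[R_1,R_2]$. If the problem $$ (\ast)\qquad\begin{cases} -\Delta_1^N u=1 & \text{in }\Omega,\\ u=0,\quad -\dfrac{\partial u}{\partial\nu}=q\big(|x-\bar x|,\,H(x)\big) & \text{on }\partial\Omega \end{cases} $$ has a solution $u$ which is smooth near the boundary, then $R_1=R_2$ (i.e. $\Omega=B(\bar x,R_1)$).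
   Context: $B(\bar x,R)$ is the open ball of center $\bar x$ and radius $R$. The mean curvature $H$ is the arithmetic mean of the $n-1$ principal curvatures, with the sign convention that the sphere $\partial B(\bar x,R)$ has $H=1/R$. Normalized $1$-Laplacian. For $\varphi$ twice differentiable at $x_0$ with $D\varphi(x_0)\ne0$, $$\Delta_1^N\varphi=|D\varphi|\,\mathrm{div}\big(|D\varphi|^{-1}D\varphi\big)=\Delta\varphi-|D\varphi|^{-2}\langle D^2\varphi\,D\varphi,D\varphi\rangle,$$ and one sets $\Delta_1^+\varphi(x_0)=\Delta_1^-\varphi(x_0)=\Delta_1^N\varphi(x_0)$. If $D\varphi(x_0)=0$ and $\lambda_1\le\dots\le\lambda_n$ are the eigenvalues of $D^2\varphi(x_0)$, one sets $\Delta_1^+\varphi(x_0)=\sum_{i=2}^n\lambda_i$ and $\Delta_1^-\varphi(x_0)=\sum_{i=1}^{n-1}\lambda_i$. Viscosity solution of $(\ast)$. For $x_0\in\overline\Omega$ write $u\prec_{x_0}\varphi$ (resp. $u\succ_{x_0}\varphi$) if $u-\varphi$ has a local maximum (resp. local minimum) at $x_0$, relative to $\overline\Omega$. A viscosity solution of $(\ast)$ is a function $u\in C(\overline\Omega)$ such that: (i) for every $x_0\in\Omega$ and every $\varphi\in C^2(\Omega)$, if $u\prec_{x_0}\varphi$ then $-\Delta_1^+\varphi(x_0)\le1$, and if $u\succ_{x_0}\varphi$ then $-\Delta_1^-\varphi(x_0)\ge1$; (ii) $u=0$ on $\partial\Omega$; (iii) for every $x_0\in\partial\Omega$ and every $\varphi$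 of class $C^2$ near $x_0$, if $u\prec_{x_0}\varphi$ then $-\frac{\partial\varphi}{\partial\nu}(x_0)\ge q(|x_0-\bar x|,H(x_0))$, and if $u\succ_{x_0}\varphi$ then $-\frac{\partial\varphi}{\partial\nu}(x_0)\le q(|x_0-\bar x|,H(x_0))$. Smooth near the boundary. For $\varepsilon>0$ let $\Omega_\varepsilon=\{x\in\Omega:\mathrm{dist}(x,\partial\Omega)<\varepsilon\}$. A viscosity solution $u$ of $(\ast)$ is a smooth solution near the boundary if for some $\varepsilon>0$: $u\in C^2(\overline\Omega_\varepsilon)$; $Du\ne0$ in $\overline\Omega_\varepsilon$; the equation $-\Delta_1^Nu=1$ is satisfied in the classical sense in $\overline\Omega_\varepsilon$; and the boundary conditions in $(\ast)$ hold pointwise on $\partial\Omega$. Since $q(r,h)$ is defined only for $h>0$, the Neumann condition is understood to include that $H(x)>0$ for all $x\in\partial\Omega$; for a solution which is smooth near the boundary and satisfies $u=0$ on $\partial\Omega$ this is automatic. *)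

theory Defs
  imports "HOL-Analysis.Analysis"
begin

section \<open>Gradient, Hessian, functions of class \<open>C\<^sup>2\<close>\<close>

definition grad :: "(real^'n \<Rightarrow> real) \<Rightarrow> real^'n \<Rightarrow> real^'n" where
  "grad f x = (THE D. GDERIV f x :> D)"

definition hess :: "(real^'n \<Rightarrow> real) \<Rightarrow> real^'n \<Rightarrow> real^'n^'n" where
  "hess f x = jacobian (grad f) (at x)"

text \<open>To be used with an open set \<open>U\<close>.\<close>

definition C2_on :: "(real^'n \<Rightarrow> real) \<Rightarrow> (real^'n) set \<Rightarrow> bool" where
  "C2_on f U \<longleftrightarrow>
     (\<forall>x\<in>U. f differentiable (at x)) \<and> (\<forall>x\<in>U. grad f differentiable (at x)) \<and>
     continuous_on U (hess f)"

text \<open>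
  Membership of \<open>f\<close> in \<open>C\<^sup>2(closure U)\<close>, for \<open>U\<close> open: \<open>f\<close> is \<open>C\<^sup>2\<close> in \<open>U\<close>, and \<open>f\<close> and its
  derivatives up to order two extend continuously to the closure. The extended gradient
  \<open>Df\<close> and Hessian \<open>D2f\<close> are uniquely determined on \<open>closure U\<close>; they give the meaning of the
  derivatives of \<open>f\<close> at points of the boundary of \<open>U\<close>.
\<close>

definition C2_closure ::
  "(real^'n \<Rightarrow> real) \<Rightarrow> (real^'n) set \<Rightarrow> (real^'n \<Rightarrow> real^'n) \<Rightarrow> (real^'n \<Rightarrow> real^'n^'n) \<Rightarrow> bool" where
  "C2_closure f U Df D2f \<longleftrightarrow>
     C2_on f U \<and> (\<forall>x\<in>U. Df x = grad f x \<and> D2f x = hess f x) \<and>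
     continuous_on (closure U) f \<and> continuous_on (closure U) Df \<and> continuous_on (closure U) D2f"


section \<open>Eigenvalues counted with multiplicity\<close>

text \<open>
  The eigenvalues of \<open>T\<close> on the subspace \<open>S\<close> in nondecreasing order, each repeated as often as
  the dimension of its eigenspace. It is only used for self-adjoint \<open>T\<close>, where the length of
  the list is \<open>dim S\<close>.
\<close>

definition eigenvalue_list :: "(real^'n) set \<Rightarrow> (real^'n \<Rightarrow> real^'n) \<Rightarrow> real list" where
  "eigenvalue_list S T =
     (THE L. sorted L \<and> (\<forall>c. count_list L c = dim {v\<in>S. T v = c *\<^sub>R v}))"


section \<open>Sets of class \<open>C\<^sup>2\<close>, outer normal, mean curvature\<close>

text \<open>
  Near each boundary point and after a rotation of the axes, \<open>\<Omega>\<close> is the region below the graph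
  of a \<open>C\<^sup>2\<close> function over the hyperplane orthogonal to a unit vector \<open>e\<close>; such a function is
  here represented by a \<open>C\<^sup>2\<close> function \<open>\<gamma>\<close> on the whole space, evaluated at the orthogonal
  projection onto that hyperplane.
\<close>

definition C2_boundary :: "(real^'n) set \<Rightarrow> bool" where
  "C2_boundary \<Omega> \<longleftrightarrow>
     (\<forall>x\<in>frontier \<Omega>. \<exists>r>0. \<exists>e \<gamma>. norm e = 1 \<and> C2_on \<gamma> UNIV \<and>
        \<Omega> \<inter> ball x r = {y \<in> ball x r. y \<bullet> e < \<gamma> (y - (y \<bullet> e) *\<^sub>R e)})"

text \<open>
  The outer unit normal at a boundary point \<open>x\<close> is the unit vector \<open>\<nu>\<close> such that directions
  making an obtuse angle with \<open>\<nu>\<close> lead into \<open>\<Omega>\<close> and those making an acute angle lead out of \<open>\<Omega>\<close>.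
\<close>

definition outer_normal :: "(real^'n) set \<Rightarrow> real^'n \<Rightarrow> real^'n" where
  "outer_normal \<Omega> x = (THE \<nu>. norm \<nu> = 1 \<and>
     (\<forall>v. v \<bullet> \<nu> < 0 \<longrightarrow> (\<forall>\<^sub>F t in at_right 0. x + t *\<^sub>R v \<in> \<Omega>)) \<and>
     (\<forall>v. v \<bullet> \<nu> > 0 \<longrightarrow> (\<forall>\<^sub>F t in at_right 0. x + t *\<^sub>R v \<notin> \<Omega>)))"

text \<open>
  The principal curvatures are the eigenvalues of the differential of the Gauss map
  \<open>outer_normal \<Omega>\<close> on the tangent space of the boundary. The derivative is taken within
  \<open>frontier \<Omega>\<close>, which determines it on tangent vectors; its values elsewhere are arbitrary
  and do not matter. On a sphere of radius \<open>R\<close> every principal curvature is \<open>1 / R\<close>.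
\<close>

definition principal_curvatures :: "(real^'n) set \<Rightarrow> real^'n \<Rightarrow> real list" where
  "principal_curvatures \<Omega> x =
     eigenvalue_list {v. v \<bullet> outer_normal \<Omega> x = 0}
       (frechet_derivative (outer_normal \<Omega>) (at x within frontier \<Omega>))"

definition mean_curvature :: "(real^'n) set \<Rightarrow> real^'n \<Rightarrow> real" where
  "mean_curvature \<Omega> x = sum_list (principal_curvatures \<Omega> x) / (real CARD('n) - 1)"


section \<open>The normalized 1-Laplacian\<close>

text \<open>The operator as a function of the gradient \<open>p\<close> and the Hessian \<open>A\<close>, for \<open>p \<noteq> 0\<close>.\<close>

definition normalized_1_laplacian :: "real^'n \<Rightarrow> real^'n^'n \<Rightarrow> real" where
  "normalized_1_laplacian p A = trace A - ((A *v p) \<bullet> p) / (norm p)\<^sup>2"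

definition laplace1_plus :: "(real^'n \<Rightarrow> real) \<Rightarrow> real^'n \<Rightarrow> real" where
  "laplace1_plus \<phi> x =
     (if grad \<phi> x \<noteq> 0 then normalized_1_laplacian (grad \<phi> x) (hess \<phi> x)
      else sum_list (tl (eigenvalue_list UNIV ((*v) (hess \<phi> x)))))"

definition laplace1_minus :: "(real^'n \<Rightarrow> real) \<Rightarrow> real^'n \<Rightarrow> real" where
  "laplace1_minus \<phi> x =
     (if grad \<phi> x \<noteq> 0 then normalized_1_laplacian (grad \<phi> x) (hess \<phi> x)
      else sum_list (butlast (eigenvalue_list UNIV ((*v) (hess \<phi> x)))))"


section \<open>The overdetermined problem\<close>

definition touches_above ::
  "(real^'n) set \<Rightarrow> (real^'n \<Rightarrow> real) \<Rightarrow> (real^'n \<Rightarrow> real) \<Rightarrow> real^'n \<Rightarrow> bool" where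
  "touches_above \<Omega> u \<phi> x \<longleftrightarrow> (\<forall>\<^sub>F y in at x within closure \<Omega>. u y - \<phi> y \<le> u x - \<phi> x)"

definition touches_below ::
  "(real^'n) set \<Rightarrow> (real^'n \<Rightarrow> real) \<Rightarrow> (real^'n \<Rightarrow> real) \<Rightarrow> real^'n \<Rightarrow> bool" where
  "touches_below \<Omega> u \<phi> x \<longleftrightarrow> (\<forall>\<^sub>F y in at x within closure \<Omega>. u y - \<phi> y \<ge> u x - \<phi> x)"

text \<open>
  \<open>q r h\<close> is only meaningful for \<open>h > 0\<close>, so positivity of the mean curvature is part of the
  boundary condition.
\<close>

definition viscosity_solution ::
  "(real^'n) set \<Rightarrow> real^'n \<Rightarrow> (real \<Rightarrow> real \<Rightarrow> real) \<Rightarrow> (real^'n \<Rightarrow> real) \<Rightarrow> bool" where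
  "viscosity_solution \<Omega> xbar q u \<longleftrightarrow>
     continuous_on (closure \<Omega>) u \<and>
     (\<forall>x\<in>\<Omega>. \<forall>\<phi>. C2_on \<phi> \<Omega> \<longrightarrow>
        (touches_above \<Omega> u \<phi> x \<longrightarrow> - laplace1_plus \<phi> x \<le> 1) \<and>
        (touches_below \<Omega> u \<phi> x \<longrightarrow> - laplace1_minus \<phi> x \<ge> 1)) \<and>
     (\<forall>x\<in>frontier \<Omega>. u x = 0) \<and>
     (\<forall>x\<in>frontier \<Omega>. mean_curvature \<Omega> x > 0) \<and>
     (\<forall>x\<in>frontier \<Omega>. \<forall>\<phi>. (\<exists>V. open V \<and> x \<in> V \<and> C2_on \<phi> V) \<longrightarrow>
        (touches_above \<Omega> u \<phi> x \<longrightarrow>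
           - (grad \<phi> x \<bullet> outer_normal \<Omega> x) \<ge> q (norm (x - xbar)) (mean_curvature \<Omega> x)) \<and>
        (touches_below \<Omega> u \<phi> x \<longrightarrow>
           - (grad \<phi> x \<bullet> outer_normal \<Omega> x) \<le> q (norm (x - xbar)) (mean_curvature \<Omega> x)))"

definition boundary_strip :: "(real^'n) set \<Rightarrow> real \<Rightarrow> (real^'n) set" where
  "boundary_strip \<Omega> \<epsilon> = {x\<in>\<Omega>. infdist x (frontier \<Omega>) < \<epsilon>}"

definition solution_smooth_near_boundary ::
  "(real^'n) set \<Rightarrow> real^'n \<Rightarrow> (real \<Rightarrow> real \<Rightarrow> real) \<Rightarrow> (real^'n \<Rightarrow> real) \<Rightarrow> bool" where
  "solution_smooth_near_boundary \<Omega> xbar q u \<longleftrightarrow>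
     viscosity_solution \<Omega> xbar q u \<and>
     (\<exists>\<epsilon>>0. \<exists>Du D2u.
        C2_closure u (boundary_strip \<Omega> \<epsilon>) Du D2u \<and>
        (\<forall>x\<in>closure (boundary_strip \<Omega> \<epsilon>).
           Du x \<noteq> 0 \<and> - normalized_1_laplacian (Du x) (D2u x) = 1) \<and>
        (\<forall>x\<in>frontier \<Omega>. u x = 0 \<and>
           - (Du x \<bullet> outer_normal \<Omega> x) = q (norm (x - xbar)) (mean_curvature \<Omega> x)))"

end

theory Submission
  imports Defs
begin

text \<open>
  Since \<open>u\<close> vanishes on the boundary, its gradient there is normal, and differentiating this
  along boundary curves identifies the tangential part of the Hessian of \<open>u\<close> with
  \<open>\<partial>u/\<partial>\<nu>\<close> times the second fundamental form. The equation therefore reads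
  \<open>- (n - 1) * H * \<partial>u/\<partial>\<nu> = 1\<close> on the boundary, that is, \<open>(n - 1) * H * q(\<bar>x - xbar\<bar>, H) = 1\<close>.
  The inscribed ball touches at a nearest boundary point and the circumscribed ball at a
  farthest one, so that \<open>H \<le> 1 / R1\<close> at the former and \<open>H \<ge> 1 / R2\<close> at the latter. As \<open>q\<close> is
  monotone in \<open>h\<close>, \<open>q(R1, 1 / R1) / R1 \<ge> 1 / (n - 1) \<ge> q(R2, 1 / R2) / R2\<close>, which excludes
  \<open>R1 < R2\<close>.
\<close>

section \<open>Gradients and Hessians\<close>

text \<open>Removing the second derivative in the gradient direction from the trace leaves the trace
  over the hyperplane orthogonal to the gradient. On the boundary this is the tangent space, which
  is why the equation sees the Hessian there only through \<open>H\<close>. The obstacle is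
  regularity. On the frontier \<open>Du\<close> and \<open>D2u\<close> are mere continuous
  extensions from inside, and the Gauss map is meaningful only on the frontier itself. Hence
  everything is differentiated along explicit curves in a graph chart, which detect tangential
  directions alone. The comparison at the nearest point runs as follows:
  \<open>R1 * H \<le> 1\<close> and the boundary identity give
  \<open>q(R1, H) \<ge> R1 / (n - 1)\<close>, and raising the second argument from \<open>H\<close>
  to \<open>1 / R1\<close> cannot decrease \<open>q\<close>. At the farthest point both inequalities
  reverse, so the two ratios are separated by the common constant \<open>1 / (n - 1)\<close> in the
  order opposite to strict growth.\<close>

lemma has_derivative_grad:
  fixes f :: "real^'n \<Rightarrow> real"
  assumes "f differentiable (at x)"
  shows "(f has_derivative (\<lambda>h. h \<bullet> grad f x)) (at x)"
proof -
  let ?F = "frechet_derivative f (at x)"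
  have F: "(f has_derivative ?F) (at x)"
    using assms by (simp add: frechet_derivative_works)
  then have lin: "linear ?F"
    by (rule has_derivative_linear)
  define D where "D = adjoint ?F 1"
  have D: "?F h = h \<bullet> D" for h
    using adjoint_works[OF lin, of h 1] by (simp add: D_def)
  have G: "GDERIV f x :> D"
  proof -
    have "?F = (\<lambda>h. h \<bullet> D)" by (rule ext) (rule D)
    then show ?thesis using F unfolding gderiv_def by simp
  qed
  have "grad f x = D"
    unfolding grad_def
  proof (rule the_equality)
    show "GDERIV f x :> D" by (rule G)
    fix D' assume "GDERIV f x :> D'"
    then have "(\<lambda>h. h \<bullet> D') = (\<lambda>h. h \<bullet> D)"
      using G unfolding gderiv_def by (rule has_derivative_unique)
    then have "\<And>h. h \<bullet> D' = h \<bullet> D" by meson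
    then show "D' = D" using vector_eq_ldot by blast
  qed
  then show ?thesis using G by (simp add: gderiv_def)
qed

lemma has_derivative_hess:
  fixes f :: "real^'n \<Rightarrow> real"
  assumes "grad f differentiable (at x)"
  shows "(grad f has_derivative (\<lambda>h. hess f x *v h)) (at x)"
  using assms unfolding hess_def jacobian_works .

text \<open>The mean value theorem in the direction \<open>u\<close> turns the second difference
  into a first difference of \<open>g\<close>; each of the two values of \<open>g\<close> is then
  linearised at \<open>x\<close>, with error at most
  \<open>\<epsilon> * t * (norm u + norm v)\<close>. The second difference is symmetric in
  \<open>u\<close> and \<open>v\<close>, while the term \<open>u \<bullet> A v\<close> is not
  visibly so.\<close>

lemma second_difference_bound:
  fixes f :: "real^'n \<Rightarrow> real"
  assumes f: "\<And>y. (f has_derivative (\<lambda>h. h \<bullet> g y)) (at y)"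
    and A: "linear A"
    and bd: "\<And>h. norm h < \<delta> \<Longrightarrow> norm (g (x + h) - g x - A h) \<le> \<epsilon> * norm h"
    and t: "t > 0" "t * (norm u + norm v) < \<delta>" and \<epsilon>: "\<epsilon> \<ge> 0"
  shows "\<bar>f (x + t *\<^sub>R u + t *\<^sub>R v) - f (x + t *\<^sub>R u) - f (x + t *\<^sub>R v) + f x - t\<^sup>2 * (u \<bullet> A v)\<bar>
          \<le> 2 * \<epsilon> * t\<^sup>2 * (norm u + norm v)\<^sup>2"
proof -
  define \<phi> where "\<phi> s = f (x + s *\<^sub>R t *\<^sub>R u + t *\<^sub>R v) - f (x + s *\<^sub>R t *\<^sub>R u)" for s
  have "(\<phi> has_real_derivative
      (t *\<^sub>R u) \<bullet> g (x + s *\<^sub>R t *\<^sub>R u + t *\<^sub>R v) - (t *\<^sub>R u) \<bullet> g (x + s *\<^sub>R t *\<^sub>R u)) (at s)" for s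
    unfolding \<phi>_def has_field_derivative_def
    by (rule derivative_eq_intros has_derivative_compose[OF _ f] | force simp: algebra_simps)+
  then obtain s where s: "0 < s" "s < 1" and
    eq: "\<phi> 1 - \<phi> 0 = (t *\<^sub>R u) \<bullet> (g (x + (s *\<^sub>R t *\<^sub>R u + t *\<^sub>R v)) - g (x + s *\<^sub>R t *\<^sub>R u))"
    using MVT2[of 0 1 \<phi>] by (force simp: inner_diff_right add.assoc)
  let ?h = "s *\<^sub>R t *\<^sub>R u + t *\<^sub>R v" and ?k = "s *\<^sub>R t *\<^sub>R u" and ?N = "t * (norm u + norm v)"
  have k: "norm ?k \<le> t * norm u"
    using s t by (simp add: mult_left_le_one_le)
  have kN: "norm ?k \<le> ?N"
    using k t by (smt (verit) norm_ge_zero mult_left_mono)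
  have hN: "norm ?h \<le> ?N"
    using norm_triangle_ineq[of ?k "t *\<^sub>R v"] k t by (simp add: algebra_simps)
  have Ad: "A ?h - A ?k = t *\<^sub>R A v"
    using A by (simp add: linear_add linear_cmul)
  have b1: "norm (g (x + ?h) - g x - A ?h) \<le> \<epsilon> * ?N"
    using bd[of ?h] hN t \<epsilon> by (smt (verit) mult_left_mono)
  have b2: "norm (g (x + ?k) - g x - A ?k) \<le> \<epsilon> * ?N"
    using bd[of ?k] kN t \<epsilon> by (smt (verit) mult_left_mono)
  have "norm (g (x + ?h) - g (x + ?k) - t *\<^sub>R A v) \<le> 2 * \<epsilon> * ?N"
  proof -
    have "g (x + ?h) - g (x + ?k) - t *\<^sub>R A v
        = (g (x + ?h) - g x - A ?h) - (g (x + ?k) - g x - A ?k)"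
      unfolding Ad[symmetric] by simp
    then show ?thesis
      using b1 b2 norm_triangle_ineq4[of "g (x + ?h) - g x - A ?h" "g (x + ?k) - g x - A ?k"]
      by (simp only:)
  qed
  then have "\<bar>(t *\<^sub>R u) \<bullet> (g (x + ?h) - g (x + ?k) - t *\<^sub>R A v)\<bar> \<le> (t * norm u) * (2 * \<epsilon> * ?N)"
    using t by (intro order_trans[OF Cauchy_Schwarz_ineq2] mult_mono) auto
  also have "\<dots> \<le> ?N * (2 * \<epsilon> * ?N)"
    using t \<epsilon> by (intro mult_right_mono) (auto intro!: mult_nonneg_nonneg)
  finally have "\<bar>\<phi> 1 - \<phi> 0 - t\<^sup>2 * (u \<bullet> A v)\<bar> \<le> 2 * \<epsilon> * t\<^sup>2 * (norm u + norm v)\<^sup>2"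
    unfolding eq by (simp add: inner_diff_right power2_eq_square algebra_simps)
  then show ?thesis by (simp add: \<phi>_def algebra_simps)
qed

text \<open>One symmetric second difference approximates both
  \<open>t\<^sup>2 * (u \<bullet> A v)\<close> and \<open>t\<^sup>2 * (v \<bullet> A u)\<close>, so
  these agree up to an arbitrarily small multiple of \<open>t\<^sup>2\<close>.\<close>

lemma second_derivative_symmetric:
  fixes f :: "real^'n \<Rightarrow> real"
  assumes f: "\<And>y. (f has_derivative (\<lambda>h. h \<bullet> g y)) (at y)"
    and g: "(g has_derivative A) (at x)"
  shows "u \<bullet> A v = v \<bullet> A u"
proof (rule ccontr)
  assume ne: "u \<bullet> A v \<noteq> v \<bullet> A u"
  define M where "M = (norm u + norm v)\<^sup>2"
  have lin: "linear A" using g by (rule has_derivative_linear)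
  have "u \<noteq> 0"
    using ne lin by (auto simp: linear_0)
  then have M: "M > 0" unfolding M_def
    by (smt (verit) norm_ge_zero zero_less_norm_iff zero_less_power)
  \<comment> \<open>The two errors add up to \<open>4 * \<epsilon> * M\<close> after division by
    \<open>t\<^sup>2\<close>; the factor 8 makes this half of the supposed discrepancy.\<close>
  define \<epsilon> where "\<epsilon> = \<bar>u \<bullet> A v - v \<bullet> A u\<bar> / (8 * M)"
  have \<epsilon>: "\<epsilon> > 0" using ne M by (simp add: \<epsilon>_def)
  obtain \<delta> where \<delta>: "\<delta> > 0"
    "\<And>y. norm (y - x) < \<delta> \<Longrightarrow> norm (g y - g x - A (y - x)) \<le> \<epsilon> * norm (y - x)"
    using g \<epsilon> unfolding has_derivative_at_alt by blast
  have bd: "norm (g (x + h) - g x - A h) \<le> \<epsilon> * norm h" if "norm h < \<delta>" for h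
    using \<delta>(2)[of "x + h"] that by simp
  define t where "t = \<delta> / (2 * (norm u + norm v))"
  have pos: "norm u + norm v > 0" using \<open>u \<noteq> 0\<close> by (simp add: add_pos_nonneg)
  have t: "t > 0" "t * (norm u + norm v) < \<delta>" "t * (norm v + norm u) < \<delta>"
    using \<delta>(1) pos unfolding t_def by (simp_all add: add.commute[of "norm v"] divide_less_eq)
  have 1: "\<bar>f (x + t *\<^sub>R u + t *\<^sub>R v) - f (x + t *\<^sub>R u) - f (x + t *\<^sub>R v) + f x - t\<^sup>2 * (u \<bullet> A v)\<bar>
      \<le> 2 * \<epsilon> * t\<^sup>2 * M"
    unfolding M_def using second_difference_bound[OF f lin bd t(1,2)] \<epsilon> by simp
  have 2: "\<bar>f (x + t *\<^sub>R u + t *\<^sub>R v) - f (x + t *\<^sub>R u) - f (x + t *\<^sub>R v) + f x - t\<^sup>2 * (v \<bullet> A u)\<bar>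
      \<le> 2 * \<epsilon> * t\<^sup>2 * M"
    unfolding M_def using second_difference_bound[OF f lin bd t(1,3)] \<epsilon> by (simp add: algebra_simps)
  have "\<bar>t\<^sup>2 * (u \<bullet> A v) - t\<^sup>2 * (v \<bullet> A u)\<bar> \<le> 4 * \<epsilon> * t\<^sup>2 * M"
    using 1 2 by linarith
  then have "\<bar>t\<^sup>2 * (u \<bullet> A v - v \<bullet> A u)\<bar> \<le> t\<^sup>2 * (4 * \<epsilon> * M)"
    by (simp add: algebra_simps)
  then have "t\<^sup>2 * \<bar>u \<bullet> A v - v \<bullet> A u\<bar> \<le> t\<^sup>2 * (4 * \<epsilon> * M)"
    by (simp add: abs_mult)
  then have "\<bar>u \<bullet> A v - v \<bullet> A u\<bar> \<le> 4 * \<epsilon> * M"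
    using t(1) by simp
  then show False
    using M ne by (simp add: \<epsilon>_def)
qed

section \<open>Symmetric operators on a subspace\<close>

text \<open>A maximiser \<open>b\<close> of the quadratic form on the unit sphere of
  \<open>S\<close> is an eigenvector: its residue \<open>z = T b - c *\<^sub>R b\<close> is
  orthogonal to \<open>b\<close>, and a nonzero \<open>z\<close> would be a direction of first-order
  increase.\<close>

lemma symmetric_Rayleigh_max_eigenvector:
  fixes T :: "'a::euclidean_space \<Rightarrow> 'a"
  assumes T: "linear T" and S: "subspace S" and inv: "\<And>v. v \<in> S \<Longrightarrow> T v \<in> S"
    and sym: "\<And>v w. v \<in> S \<Longrightarrow> w \<in> S \<Longrightarrow> v \<bullet> T w = w \<bullet> T v"
    and ne: "dim S \<noteq> 0"
  obtains b c where "b \<in> S" "norm b = 1" "T b = c *\<^sub>R b"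
proof -
  have "S \<inter> sphere 0 1 \<noteq> {}"
  proof -
    obtain v where v: "v \<in> S" "v \<noteq> 0" using ne by (auto simp: dim_eq_0)
    then have "v /\<^sub>R norm v \<in> S \<inter> sphere 0 1"
      using S by (simp add: subspace_scale)
    then show ?thesis by blast
  qed
  moreover have "compact (S \<inter> sphere 0 1)"
    using closed_subspace[OF S] by (simp add: closed_Int_compact)
  moreover have "continuous_on (S \<inter> sphere 0 1) (\<lambda>v. v \<bullet> T v)"
    using T by (intro continuous_intros linear_continuous_on_compose[where g=T]) auto
  ultimately obtain b where b: "b \<in> S" "norm b = 1"
    and max: "\<And>v. v \<in> S \<Longrightarrow> norm v = 1 \<Longrightarrow> v \<bullet> T v \<le> b \<bullet> T b"
    using continuous_attains_sup[of "S \<inter> sphere 0 1" "\<lambda>v. v \<bullet> T v"] by force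
  define c where "c = b \<bullet> T b"
  have le: "v \<bullet> T v \<le> c * (norm v)\<^sup>2" if v: "v \<in> S" for v
  proof (cases "v = 0")
    case False
    have "(v /\<^sub>R norm v) \<bullet> T (v /\<^sub>R norm v) \<le> c"
      unfolding c_def using v S False by (intro max) (auto simp: subspace_scale)
    then show ?thesis
      using False T by (simp add: linear_cmul power2_eq_square field_simps)
  qed (use T in \<open>simp add: linear_0\<close>)
  define z where "z = T b - c *\<^sub>R b"
  have bb: "b \<bullet> b = 1" using b by (simp add: dot_square_norm)
  have z: "z \<in> S" "z \<bullet> b = 0"
    using b inv S bb
    by (auto simp: z_def subspace_diff subspace_scale c_def inner_diff_left inner_commute[of "T b"])
  have zTb: "z \<bullet> T b = z \<bullet> z"
    using z by (simp add: z_def inner_diff_right inner_diff_left algebra_simps inner_commute)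
  \<comment> \<open>The homogeneous form \<open>le\<close> of maximality applies to
    \<open>b + t *\<^sub>R z\<close> without normalising it; a term linear in \<open>t\<close> ends
    up below a quadratic one.\<close>
  have "2 * t * (z \<bullet> z) \<le> t\<^sup>2 * (c * (z \<bullet> z) - z \<bullet> T z)" for t
  proof -
    have "(b + t *\<^sub>R z) \<bullet> T (b + t *\<^sub>R z) \<le> c * (norm (b + t *\<^sub>R z))\<^sup>2"
      using b z S by (intro le) (auto simp: subspace_add subspace_scale)
    moreover have "(b + t *\<^sub>R z) \<bullet> T (b + t *\<^sub>R z) = c + 2 * t * (z \<bullet> T b) + t\<^sup>2 * (z \<bullet> T z)"
      using T sym[OF b(1) z(1)]
      by (simp add: linear_add linear_cmul inner_add_left inner_add_right c_def power2_eq_square algebra_simps)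
    moreover have "(norm (b + t *\<^sub>R z))\<^sup>2 = 1 + t\<^sup>2 * (z \<bullet> z)"
    proof -
      have "b \<bullet> z = 0" using z by (simp add: inner_commute)
      then show ?thesis using z bb unfolding power2_norm_eq_inner
        by (simp add: inner_add_left inner_add_right power2_eq_square)
    qed
    ultimately show ?thesis by (simp add: zTb algebra_simps)
  qed
  note small = this
  have "z \<bullet> z \<le> 0"
  proof (rule ccontr)
    assume "\<not> z \<bullet> z \<le> 0"
    then have pos: "z \<bullet> z > 0" by (simp only: not_le)
    \<comment> \<open>The summand \<open>z \<bullet> z\<close> keeps \<open>K\<close> positive, so
      that one may divide by it; the choice of \<open>t\<close> below then reduces the inequality to
      \<open>2 * t * (z \<bullet> z) \<le> t * (z \<bullet> z)\<close>.\<close>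
    define K where "K = \<bar>c * (z \<bullet> z) - z \<bullet> T z\<bar> + z \<bullet> z"
    have K: "K > 0" "c * (z \<bullet> z) - z \<bullet> T z \<le> K"
      unfolding K_def using pos by linarith+
    define t where "t = (z \<bullet> z) / K"
    have t: "t > 0" using pos K by (simp add: t_def)
    have "2 * t * (z \<bullet> z) \<le> t\<^sup>2 * K"
      using small[of t] K(2) by (smt (verit) mult_left_mono zero_le_power2)
    also have "\<dots> = t * (z \<bullet> z)" using K by (simp add: t_def power2_eq_square)
    finally show False using t pos by simp
  qed
  then have "z = 0" by (metis inner_gt_zero_iff linorder_not_le)
  then show thesis using that[of b c] b by (simp add: z_def)
qed

text \<open>Induction splits off one eigenvector at a time; symmetry keeps its orthogonal complement
  in \<open>S\<close> invariant. Symmetry is asked on \<open>S\<close> alone because the derivative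
  of the Gauss map is controlled on tangent vectors only.\<close>

lemma symmetric_eigenbasis:
  fixes T :: "'a::euclidean_space \<Rightarrow> 'a"
  assumes T: "linear T" and "subspace S" and "\<And>v. v \<in> S \<Longrightarrow> T v \<in> S"
    and "\<And>v w. v \<in> S \<Longrightarrow> w \<in> S \<Longrightarrow> v \<bullet> T w = w \<bullet> T v"
  shows "\<exists>B \<mu>. B \<subseteq> S \<and> finite B \<and> pairwise orthogonal B \<and> span B = S \<and>
    (\<forall>b\<in>B. norm b = 1 \<and> T b = \<mu> b *\<^sub>R b)"
  using assms(2-)
proof (induction "dim S" arbitrary: S rule: less_induct)
  case less
  show ?case
  proof (cases "dim S = 0")
    case True
    then have "S = {0}" using less.prems(1) by (auto simp: dim_eq_0 subspace_0)
    then show ?thesis by (intro exI[of _ "{}"]) auto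
  next
    case False
    obtain b c where b: "b \<in> S" "norm b = 1" "T b = c *\<^sub>R b"
      using symmetric_Rayleigh_max_eigenvector[OF T less.prems False] by blast
    have bb: "b \<bullet> b = 1" using b by (simp add: dot_square_norm)
    define S' where "S' = {v\<in>S. v \<bullet> b = 0}"
    have sub: "subspace S'"
      using less.prems(1) by (auto simp: S'_def subspace_def inner_add_left)
    have "S' \<subseteq> S" "b \<in> S - S'" using b bb by (auto simp: S'_def)
    then have "S' \<subset> S" by blast
    then have dim: "dim S' < dim S"
      using sub less.prems(1) by (metis dim_psubset span_eq_iff)
    have "\<exists>B \<mu>. B \<subseteq> S' \<and> finite B \<and> pairwise orthogonal B \<and> span B = S' \<and>
        (\<forall>b\<in>B. norm b = 1 \<and> T b = \<mu> b *\<^sub>R b)"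
    proof (rule less.hyps[OF dim sub])
      show "T v \<in> S'" if "v \<in> S'" for v
        using that less.prems(2)[of v] less.prems(3)[of v b] b
        by (simp add: S'_def inner_commute)
      show "v \<bullet> T w = w \<bullet> T v" if "v \<in> S'" "w \<in> S'" for v w
        using that less.prems(3) by (simp add: S'_def)
    qed
    then obtain B \<mu> where B: "B \<subseteq> S'" "finite B" "pairwise orthogonal B" "span B = S'"
      "\<forall>b\<in>B. norm b = 1 \<and> T b = \<mu> b *\<^sub>R b"
      by blast
    have notin: "b \<notin> B" using B(1) bb by (auto simp: S'_def)
    have "span (insert b B) = S"
    proof
      show "span (insert b B) \<subseteq> S"
        using b B(1) less.prems(1) by (intro span_minimal) (auto simp: S'_def)
      show "S \<subseteq> span (insert b B)"
      proof
        fix v assume v: "v \<in> S"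
        have "v - (v \<bullet> b) *\<^sub>R b \<in> span B"
          unfolding B(4) S'_def using v b bb less.prems(1)
          by (simp add: subspace_diff subspace_scale inner_diff_left)
        then show "v \<in> span (insert b B)"
          using span_breakdown_eq by blast
      qed
    qed
    moreover have "pairwise orthogonal (insert b B)"
      using B(1,3) by (auto simp: pairwise_insert S'_def orthogonal_def inner_commute)
    ultimately show ?thesis
      using b B notin
      by (intro exI[of _ "insert b B"] exI[of _ "\<lambda>x. if x = b then c else \<mu> x"]) (auto simp: S'_def)
  qed
qed

text \<open>Comparing the coefficients of \<open>T v\<close> and \<open>c *\<^sub>R v\<close> in the
  basis kills every coefficient with \<open>\<mu> b \<noteq> c\<close>, so the eigenspace is spanned
  by the remaining, independent basis vectors.\<close>

lemma eigenspace_dim: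
  fixes T :: "'a::euclidean_space \<Rightarrow> 'a"
  assumes T: "linear T" and B: "finite B" "pairwise orthogonal B" "span B = S"
    and eig: "\<And>b. b \<in> B \<Longrightarrow> norm b = 1 \<and> T b = \<mu> b *\<^sub>R b"
  shows "dim {v\<in>S. T v = c *\<^sub>R v} = card {b\<in>B. \<mu> b = c}"
proof -
  let ?E = "{b\<in>B. \<mu> b = c}"
  have ip: "b \<bullet> b' = (if b = b' then 1 else 0)" if "b \<in> B" "b' \<in> B" for b b'
    using that B(2) eig by (auto simp: pairwise_def orthogonal_def dot_square_norm)
  have "{v\<in>S. T v = c *\<^sub>R v} = span ?E"
  proof
    show "span ?E \<subseteq> {v\<in>S. T v = c *\<^sub>R v}"
    proof (rule span_minimal)
      show "?E \<subseteq> {v\<in>S. T v = c *\<^sub>R v}"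
        using B(3) eig by (auto intro: span_base)
      show "subspace {v\<in>S. T v = c *\<^sub>R v}"
        unfolding B(3)[symmetric] using T
        by (auto simp: subspace_def linear_0 linear_add linear_cmul span_add span_scale
            span_zero scaleR_add_right)
    qed
    show "{v\<in>S. T v = c *\<^sub>R v} \<subseteq> span ?E"
    proof
      fix v assume "v \<in> {v\<in>S. T v = c *\<^sub>R v}"
      then have v: "v \<in> span B" "T v = c *\<^sub>R v" using B(3) by auto
      have exp: "v = (\<Sum>b\<in>B. (v \<bullet> b) *\<^sub>R b)"
        using orthonormal_basis_expand[OF B(2) _ v(1) B(1)] eig by simp
      have zero: "v \<bullet> b = 0" if b: "b \<in> B" "\<mu> b \<noteq> c" for b
      proof -
        have "T v = (\<Sum>b\<in>B. ((v \<bullet> b) * \<mu> b) *\<^sub>R b)"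
          by (subst exp) (use T eig in \<open>simp add: linear_sum linear_cmul\<close>)
        then have "T v \<bullet> b = (\<Sum>b'\<in>B. ((v \<bullet> b') * \<mu> b') * (b' \<bullet> b))"
          by (simp add: inner_sum_left)
        also have "\<dots> = (\<Sum>b'\<in>B. if b' = b then (v \<bullet> b) * \<mu> b else 0)"
          by (rule sum.cong) (auto simp: ip b)
        also have "\<dots> = (v \<bullet> b) * \<mu> b"
          using B(1) b by simp
        finally show ?thesis using v(2) b(2) by simp
      qed
      have "(\<Sum>b\<in>B. (v \<bullet> b) *\<^sub>R b) \<in> span ?E"
      proof (rule span_sum)
        fix b assume "b \<in> B"
        then show "(v \<bullet> b) *\<^sub>R b \<in> span ?E"
          by (cases "\<mu> b = c") (auto simp: zero intro: span_scale span_base span_zero)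
      qed
      then show "v \<in> span ?E" using exp by simp
    qed
  qed
  moreover have "independent ?E"
  proof (rule pairwise_orthogonal_independent)
    show "pairwise orthogonal ?E" using B(2) by (rule pairwise_subset) auto
    show "0 \<notin> ?E" using eig by force
  qed
  ultimately show ?thesis
    by (metis dim_span_eq_card_independent)
qed

lemma count_list_sorted_list_of_multiset:
  "count_list (sorted_list_of_multiset M) c = count M c"
  by (metis count_mset mset_sorted_list_of_multiset)

text \<open>The prescribed dimensions fix the multiset of the list, and a sorted list is determined
  by its multiset; this makes the definite description well defined.\<close>

lemma eigenvalue_list_eqI:
  fixes T :: "real^'n \<Rightarrow> real^'n"
  assumes T: "linear T" and B: "finite B" "pairwise orthogonal B" "span B = S"
    and eig: "\<And>b. b \<in> B \<Longrightarrow> norm b = 1 \<and> T b = \<mu> b *\<^sub>R b"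
  shows "eigenvalue_list S T = sorted_list_of_multiset (image_mset \<mu> (mset_set B))"
  unfolding eigenvalue_list_def
proof (rule the_equality)
  let ?M = "image_mset \<mu> (mset_set B)"
  have cnt: "count ?M c = dim {v\<in>S. T v = c *\<^sub>R v}" for c
    unfolding eigenspace_dim[OF T B eig, simplified] count_image_mset
    using B(1) by (simp add: vimage_def Int_def conj_commute)
  show "sorted (sorted_list_of_multiset ?M) \<and>
      (\<forall>c. count_list (sorted_list_of_multiset ?M) c = dim {v\<in>S. T v = c *\<^sub>R v})"
    by (simp add: count_list_sorted_list_of_multiset cnt)
  fix L assume L: "sorted L \<and> (\<forall>c. count_list L c = dim {v\<in>S. T v = c *\<^sub>R v})"
  then have "mset L = ?M"
    by (intro multiset_eqI) (simp add: cnt count_mset)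
  then show "L = sorted_list_of_multiset ?M"
    using L by (metis sorted_list_of_multiset_mset sorted_sort_id)
qed

text \<open>The eigenvalues are traded for values of the quadratic form on a basis of
  \<open>S\<close>, so that \<open>T\<close> can afterwards be replaced by any map agreeing with it
  on \<open>S\<close>.\<close>

lemma sum_eigenvalue_list:
  fixes T :: "real^'n \<Rightarrow> real^'n"
  assumes T: "linear T" and S: "subspace S" and inv: "\<And>v. v \<in> S \<Longrightarrow> T v \<in> S"
    and sym: "\<And>v w. v \<in> S \<Longrightarrow> w \<in> S \<Longrightarrow> v \<bullet> T w = w \<bullet> T v"
  obtains B where "finite B" "pairwise orthogonal B" "span B = S" "\<And>b. b \<in> B \<Longrightarrow> norm b = 1"
    "sum_list (eigenvalue_list S T) = (\<Sum>b\<in>B. b \<bullet> T b)"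
proof -
  obtain B \<mu> where B: "finite B" "pairwise orthogonal B" "span B = S"
    and eig: "\<And>b. b \<in> B \<Longrightarrow> norm b = 1 \<and> T b = \<mu> b *\<^sub>R b"
    using symmetric_eigenbasis[OF T S inv sym] by blast
  have "eigenvalue_list S T = sorted_list_of_multiset (image_mset \<mu> (mset_set B))"
    using T B eig by (rule eigenvalue_list_eqI)
  then have "sum_list (eigenvalue_list S T) = sum_mset (image_mset \<mu> (mset_set B))"
    by (simp only: mset_sorted_list_of_multiset flip: sum_mset_sum_list)
  also have "\<dots> = (\<Sum>b\<in>B. \<mu> b)"
    by (simp add: sum_unfold_sum_mset)
  also have "\<dots> = (\<Sum>b\<in>B. b \<bullet> T b)"
    by (rule sum.cong) (use eig in \<open>auto simp: dot_square_norm\<close>)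
  finally show thesis using that[of B] B eig by blast
qed

text \<open>Parseval's identity \<open>e\<close>, applied to each row of \<open>A\<close> against
  the matching coordinate vector.\<close>

lemma trace_orthonormal_basis:
  fixes A :: "real^'n^'n"
  assumes B: "finite B" "pairwise orthogonal B" "span B = UNIV" "\<And>b. b \<in> B \<Longrightarrow> norm b = 1"
  shows "trace A = (\<Sum>b\<in>B. b \<bullet> (A *v b))"
proof -
  have e: "(\<Sum>b\<in>B. (x \<bullet> b) * (b \<bullet> y)) = x \<bullet> y" for x y :: "real^'n"
  proof -
    have "x \<bullet> y = (\<Sum>b\<in>B. (x \<bullet> b) *\<^sub>R b) \<bullet> y"
      using orthonormal_basis_expand[OF B(2,4) _ B(1), of x] B(3) by simp
    then show ?thesis by (simp add: inner_sum_left)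
  qed
  have "(\<Sum>b\<in>B. b \<bullet> (A *v b)) = (\<Sum>b\<in>B. \<Sum>i\<in>UNIV. b $ i * (A $ i \<bullet> b))"
    by (simp add: inner_vec_def[of _ "A *v _"] matrix_vector_mul_component)
  also have "\<dots> = (\<Sum>i\<in>UNIV. \<Sum>b\<in>B. (A $ i \<bullet> b) * (b \<bullet> axis i 1))"
    by (subst sum.swap) (simp add: inner_axis mult.commute)
  also have "\<dots> = trace A"
    unfolding e by (simp add: trace_def inner_axis)
  finally show ?thesis ..
qed

text \<open>If \<open>c > 0\<close>, then \<open>\<phi>'\<close> is positive just to the right of
  its zero at 0, and the mean value theorem pushes \<open>\<phi>\<close> above
  \<open>\<phi> 0\<close>. The second derivative is asked at 0 only, as supplied by
  \<open>has_vector_derivative_curve'\<close>.\<close>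

lemma second_derivative_at_local_max:
  fixes \<phi> \<phi>' :: "real \<Rightarrow> real"
  assumes \<phi>: "\<And>t. (\<phi> has_real_derivative \<phi>' t) (at t)"
    and \<phi>': "(\<phi>' has_real_derivative c) (at 0)"
    and max: "\<forall>\<^sub>F t in at 0. \<phi> t \<le> \<phi> 0"
  shows "\<phi>' 0 = 0" "c \<le> 0"
proof -
  obtain d where d: "d > 0" "\<And>t. \<bar>t\<bar> < d \<Longrightarrow> \<phi> t \<le> \<phi> 0"
  proof -
    from max obtain d where "d > 0" and d: "\<And>t. t \<noteq> 0 \<Longrightarrow> \<bar>t\<bar> < d \<Longrightarrow> \<phi> t \<le> \<phi> 0"
      unfolding eventually_at by (auto simp: dist_real_def)
    have "\<phi> t \<le> \<phi> 0" if "\<bar>t\<bar> < d" for t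
      using d[OF _ that] by (cases "t = 0") auto
    with \<open>d > 0\<close> show thesis by (rule that)
  qed
  show zero: "\<phi>' 0 = 0"
    using DERIV_local_max[OF \<phi> d(1)] d(2) by simp
  show "c \<le> 0"
  proof (rule ccontr)
    assume "\<not> c \<le> 0"
    then obtain k where k: "k > 0" "\<And>h. 0 < h \<Longrightarrow> h < k \<Longrightarrow> \<phi>' h > 0"
      using DERIV_pos_inc_right[OF \<phi>'] zero by auto
    define t where "t = min d k / 2"
    have t: "0 < t" "t < d" "t < k" using d(1) k(1) by (auto simp: t_def)
    obtain z where "0 < z" "z < t" "\<phi> t - \<phi> 0 = (t - 0) * \<phi>' z"
      using MVT2[OF t(1) \<phi>] by blast
    then have "\<phi> t > \<phi> 0" using k(2)[of z] t by (smt (verit) mult_pos_pos)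
    then show False using d(2)[of t] t by simp
  qed
qed

section \<open>A chart of the boundary\<close>

locale graph_chart =
  fixes \<Omega> :: "(real^'n) set" and x e :: "real^'n" and r :: real and \<gamma> :: "real^'n \<Rightarrow> real"
  assumes open_domain: "open \<Omega>" and frontier_x: "x \<in> frontier \<Omega>" and r_pos: "r > 0"
    and norm_e: "norm e = 1" and C2_graph: "C2_on \<gamma> UNIV"
    and domain_eq: "\<Omega> \<inter> ball x r = {y \<in> ball x r. y \<bullet> e < \<gamma> (y - (y \<bullet> e) *\<^sub>R e)}"
begin

text \<open>
  \<open>G\<close> is a defining function of the domain in the chart and \<open>w\<close> its gradient, so that \<open>N\<close> is
  the outer normal on the boundary, extended to the whole space; \<open>curve y v\<close> runs in the
  boundary through \<open>y\<close> and has velocity \<open>v\<close> there when \<open>v\<close> is tangent.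
\<close>

definition P :: "real^'n \<Rightarrow> real^'n" where "P y = y - (y \<bullet> e) *\<^sub>R e"
definition G :: "real^'n \<Rightarrow> real" where "G y = y \<bullet> e - \<gamma> (P y)"
definition w :: "real^'n \<Rightarrow> real^'n" where "w y = e - P (grad \<gamma> (P y))"
definition dw :: "real^'n \<Rightarrow> real^'n \<Rightarrow> real^'n" where "dw y h = - P (hess \<gamma> (P y) *v P h)"
definition N :: "real^'n \<Rightarrow> real^'n" where "N y = w y /\<^sub>R norm (w y)"
definition dN :: "real^'n \<Rightarrow> real^'n \<Rightarrow> real^'n" where "dN y = frechet_derivative N (at y)"
definition curve :: "real^'n \<Rightarrow> real^'n \<Rightarrow> real \<Rightarrow> real^'n" where
  "curve y v t = P y + t *\<^sub>R P v + \<gamma> (P y + t *\<^sub>R P v) *\<^sub>R e"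
definition curve' :: "real^'n \<Rightarrow> real^'n \<Rightarrow> real \<Rightarrow> real^'n" where
  "curve' y v t = P v + (P v \<bullet> grad \<gamma> (P y + t *\<^sub>R P v)) *\<^sub>R e"

section \<open>Derivatives of the defining function and of the extended normal\<close>

lemma e_e [simp]: "e \<bullet> e = 1"
  using norm_e by (simp add: dot_square_norm)

lemma P_e [simp]: "P y \<bullet> e = 0" "e \<bullet> P y = 0" "P e = 0"
  by (simp_all add: P_def inner_diff_left inner_diff_right inner_commute)

lemma bounded_linear_P: "bounded_linear P"
  unfolding P_def by (intro bounded_linear_intros)

lemma linear_P: "linear P"
  using bounded_linear_P by (rule bounded_linear.linear)

lemmas P_simps [simp] = linear_add[OF linear_P] linear_cmul[OF linear_P] linear_diff[OF linear_P]
  linear_neg[OF linear_P] linear_0[OF linear_P]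

lemma P_P [simp]: "P (P y) = P y"
  by (simp add: P_def[of "P y"])

lemma P_decomp: "y = P y + (y \<bullet> e) *\<^sub>R e"
  by (simp add: P_def)

lemma P_adjoint: "P u \<bullet> v = u \<bullet> P v"
  by (simp add: P_def inner_diff_left inner_diff_right inner_commute)

lemmas has_derivative_P = bounded_linear.has_derivative[OF bounded_linear_P]

lemma has_derivative_graph: "(\<gamma> has_derivative (\<lambda>h. h \<bullet> grad \<gamma> y)) (at y)"
  using C2_graph has_derivative_grad by (auto simp: C2_on_def)

lemma has_derivative_grad_graph: "(grad \<gamma> has_derivative (\<lambda>h. hess \<gamma> y *v h)) (at y)"
  using C2_graph has_derivative_hess by (auto simp: C2_on_def)

lemma has_derivative_G: "(G has_derivative (\<lambda>h. h \<bullet> w y)) (at y)"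
proof -
  have "(G has_derivative (\<lambda>h. h \<bullet> e - P h \<bullet> grad \<gamma> (P y))) (at y)"
    unfolding G_def
    by (intro derivative_intros has_derivative_compose[OF has_derivative_P has_derivative_graph])
  then show ?thesis by (simp add: w_def inner_diff_right P_adjoint)
qed

lemma has_derivative_w: "(w has_derivative dw y) (at y)"
proof -
  have "(w has_derivative (\<lambda>h. 0 - P (hess \<gamma> (P y) *v P h))) (at y)"
    unfolding w_def
    by (intro derivative_intros has_derivative_P
        has_derivative_compose[OF has_derivative_P has_derivative_grad_graph])
  then show ?thesis by (simp add: dw_def[abs_def])
qed

text \<open>Up to sign, \<open>dw y\<close> is the Hessian of the graph function compressed by the
  self-adjoint projection \<open>P\<close>.\<close>

lemma dw_symmetric: "u \<bullet> dw y v = v \<bullet> dw y u"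
  using second_derivative_symmetric[OF has_derivative_graph has_derivative_grad_graph, of "P u" "P y" "P v"]
  by (simp add: dw_def P_adjoint[symmetric])

lemma w_e: "w y \<bullet> e = 1" "w y \<noteq> 0"
proof -
  show "w y \<bullet> e = 1" by (simp add: w_def inner_diff_left)
  then show "w y \<noteq> 0" by force
qed

lemma norm_N [simp]: "norm (N y) = 1" and N_N [simp]: "N y \<bullet> N y = 1"
  using w_e[of y] by (simp_all add: N_def power2_norm_eq_inner[symmetric] power2_eq_square)

lemma w_eq: "w y = norm (w y) *\<^sub>R N y"
  using w_e[of y] by (simp add: N_def)

lemma N_e: "N y \<bullet> e = 1 / norm (w y)"
  using w_e[of y] by (simp add: N_def field_simps)

lemma inner_w_eq_0_iff: "v \<bullet> w y = 0 \<longleftrightarrow> v \<bullet> N y = 0"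
  using w_e[of y] by (simp add: N_def)

lemma has_derivative_N: "(N has_derivative dN y) (at y)"
proof -
  have "w differentiable (at y)"
    using has_derivative_w by (auto simp: differentiable_def)
  then have "N differentiable (at y)"
    unfolding N_def using w_e(2)[of y]
    by (intro derivative_intros differentiable_compose[where f=norm and g=w])
       (auto intro: differentiable_norm_at)
  then show ?thesis by (simp add: dN_def frechet_derivative_works)
qed

lemma N_dN [simp]: "N y \<bullet> dN y h = 0"
proof -
  have "((\<lambda>y. N y \<bullet> N y) has_derivative (\<lambda>h. N y \<bullet> dN y h + dN y h \<bullet> N y)) (at y)"
    by (intro has_derivative_inner has_derivative_N)
  then have "(\<lambda>h. N y \<bullet> dN y h + dN y h \<bullet> N y) = (\<lambda>h. 0)"
    by (intro has_derivative_unique[of "\<lambda>y. N y \<bullet> N y"]) (auto intro!: derivative_eq_intros)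
  from fun_cong[OF this, of h] show ?thesis by (simp add: inner_commute)
qed

text \<open>Differentiate \<open>w = norm w * N\<close>: the derivative of the scalar factor
  contributes a multiple of \<open>N\<close> only, which a tangent \<open>z\<close> annihilates, so
  that factor never has to be computed.\<close>

lemma dN_tangent:
  assumes "z \<bullet> N y = 0"
  shows "norm (w y) * (z \<bullet> dN y h) = z \<bullet> dw y h"
proof -
  have "(\<lambda>y. norm (w y)) differentiable (at y)"
  proof (rule differentiable_compose[where f=norm and g=w])
    show "norm differentiable (at (w y))"
      using w_e(2) by (rule differentiable_norm_at)
    show "w differentiable (at y)"
      using has_derivative_w by (auto simp: differentiable_def)
  qed
  then obtain m' where "((\<lambda>y. norm (w y)) has_derivative m') (at y)"
    by (auto simp: differentiable_def)
  then have "((\<lambda>y. norm (w y) *\<^sub>R N y) has_derivative (\<lambda>h. norm (w y) *\<^sub>R dN y h + m' h *\<^sub>R N y)) (at y)"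
    by (intro has_derivative_scaleR has_derivative_N)
  then have "(w has_derivative (\<lambda>h. norm (w y) *\<^sub>R dN y h + m' h *\<^sub>R N y)) (at y)"
    unfolding w_eq[symmetric] .
  then have "dw y = (\<lambda>h. norm (w y) *\<^sub>R dN y h + m' h *\<^sub>R N y)"
    by (rule has_derivative_unique[OF has_derivative_w])
  then show ?thesis using assms by (simp add: inner_add_right)
qed

lemma dN_symmetric:
  assumes "u \<bullet> N y = 0" "v \<bullet> N y = 0"
  shows "u \<bullet> dN y v = v \<bullet> dN y u"
proof -
  have "norm (w y) * (u \<bullet> dN y v) = norm (w y) * (v \<bullet> dN y u)"
    unfolding dN_tangent[OF assms(1)] dN_tangent[OF assms(2)] by (rule dw_symmetric)
  then show ?thesis using w_e(2)[of y] by simp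
qed

section \<open>Domain, frontier and outer normal in the chart\<close>

lemma mem_domain_iff:
  assumes "y \<in> ball x r"
  shows "y \<in> \<Omega> \<longleftrightarrow> G y < 0"
proof -
  have "y \<in> \<Omega> \<longleftrightarrow> y \<in> \<Omega> \<inter> ball x r" using assms by blast
  also have "\<dots> \<longleftrightarrow> y \<bullet> e < \<gamma> (y - (y \<bullet> e) *\<^sub>R e)"
    unfolding domain_eq using assms by blast
  finally show ?thesis by (simp add: G_def P_def)
qed

lemma continuous_G: "continuous_on UNIV G"
  by (intro continuous_at_imp_continuous_on ballI has_derivative_continuous[OF has_derivative_G])

lemma continuous_grad_graph: "continuous_on UNIV (grad \<gamma>)"
  by (intro continuous_at_imp_continuous_on ballI has_derivative_continuous[OF has_derivative_grad_graph])

lemma G_shift: "G (y - s *\<^sub>R e) = G y - s"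
  by (simp add: G_def inner_diff_left)

text \<open>The set where \<open>G > 0\<close> is open and misses the domain inside the ball.
  Conversely, a step \<open>s\<close> against \<open>e\<close> lowers \<open>G\<close> by exactly
  \<open>s\<close>, so zeros of \<open>G\<close> are limits of points of the domain.\<close>

lemma mem_frontier_iff:
  assumes y: "y \<in> ball x r"
  shows "y \<in> frontier \<Omega> \<longleftrightarrow> G y = 0"
proof
  assume f: "y \<in> frontier \<Omega>"
  then have "y \<notin> \<Omega>"
    using open_domain by (simp add: frontier_def interior_open)
  moreover have "\<not> G y > 0"
  proof
    assume "G y > 0"
    let ?V = "{z. G z > 0} \<inter> ball x r"
    have "open ?V"
      using continuous_G by (intro open_Int open_Collect_less continuous_intros) auto
    moreover have "y \<in> ?V" using y \<open>G y > 0\<close> by simp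
    moreover have "?V \<inter> \<Omega> = {}" using mem_domain_iff by force
    ultimately have "y \<notin> closure \<Omega>" by (meson disjoint_iff open_Int_closure_eq_empty)
    then show False using f by (simp add: frontier_def)
  qed
  ultimately show "G y = 0" using mem_domain_iff[OF y] by linarith
next
  assume G0: "G y = 0"
  then have "y \<notin> \<Omega>" using mem_domain_iff[OF y] by simp
  moreover have "y \<in> closure \<Omega>"
    unfolding closure_approachable
  proof (intro allI impI)
    fix \<epsilon> :: real assume "\<epsilon> > 0"
    define s where "s = min \<epsilon> (r - dist x y) / 2"
    have s: "s > 0" "s < \<epsilon>" "s < r - dist x y" using \<open>\<epsilon> > 0\<close> y by (auto simp: s_def)
    have d: "dist y (y - s *\<^sub>R e) = s"
      using s norm_e by (simp add: dist_norm)
    have "y - s *\<^sub>R e \<in> ball x r"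
      using d s dist_triangle[of x "y - s *\<^sub>R e" y] by simp
    then have "y - s *\<^sub>R e \<in> \<Omega>"
      using mem_domain_iff G_shift[of y s] G0 s by simp
    then show "\<exists>z\<in>\<Omega>. dist z y < \<epsilon>"
      using d s(2) by (metis dist_commute)
  qed
  ultimately show "y \<in> frontier \<Omega>"
    using open_domain by (simp add: frontier_def interior_open)
qed

lemma eventually_ray_mem_ball:
  assumes "y \<in> ball x r"
  shows "\<forall>\<^sub>F t in at_right 0. y + t *\<^sub>R v \<in> ball x r"
proof -
  have "((\<lambda>t. y + t *\<^sub>R v) \<longlongrightarrow> y + 0 *\<^sub>R v) (at_right 0)"
    by (intro tendsto_intros)
  then show ?thesis
    using assms topological_tendstoD[of _ "y + 0 *\<^sub>R v" _ "ball x r"] by simp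
qed

lemma G_along_ray: "((\<lambda>t. G (y + t *\<^sub>R v)) has_real_derivative v \<bullet> w y) (at 0)"
proof -
  have "((\<lambda>t. G (y + t *\<^sub>R v)) has_derivative (\<lambda>t. (t *\<^sub>R v) \<bullet> w y)) (at 0)"
    by (rule has_derivative_compose[where g=G])
       (use has_derivative_G in \<open>auto intro!: derivative_eq_intros\<close>)
  then show ?thesis by (simp add: has_field_derivative_def mult_commute_abs)
qed

text \<open>Along the ray \<open>G\<close> starts at 0 with slope \<open>v \<bullet> w y\<close>,
  and \<open>w y\<close> is a positive multiple of \<open>N y\<close>.\<close>

lemma
  assumes y: "y \<in> ball x r" "y \<in> frontier \<Omega>"
  shows ray_inside: "v \<bullet> N y < 0 \<Longrightarrow> \<forall>\<^sub>F t in at_right 0. y + t *\<^sub>R v \<in> \<Omega>"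
    and ray_outside: "v \<bullet> N y > 0 \<Longrightarrow> \<forall>\<^sub>F t in at_right 0. y + t *\<^sub>R v \<notin> \<Omega>"
proof -
  have G0: "G y = 0" using y mem_frontier_iff by simp
  have sg: "v \<bullet> w y = norm (w y) * (v \<bullet> N y)"
    by (subst w_eq) simp
  show "\<forall>\<^sub>F t in at_right 0. y + t *\<^sub>R v \<in> \<Omega>" if "v \<bullet> N y < 0"
  proof -
    have "v \<bullet> w y < 0" using that w_e(2)[of y] by (simp add: sg mult_pos_neg)
    then have "\<exists>d>0. \<forall>h>0. h < d \<longrightarrow> G (y + (0 + h) *\<^sub>R v) < G (y + 0 *\<^sub>R v)"
      by (rule DERIV_neg_dec_right[OF G_along_ray])
    then have "\<forall>\<^sub>F t in at_right 0. G (y + t *\<^sub>R v) < 0"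
      unfolding eventually_at_right_field using G0 by auto
    then show ?thesis
      using eventually_ray_mem_ball[OF y(1), of v]
      by eventually_elim (simp add: mem_domain_iff)
  qed
  show "\<forall>\<^sub>F t in at_right 0. y + t *\<^sub>R v \<notin> \<Omega>" if "v \<bullet> N y > 0"
  proof -
    have "v \<bullet> w y > 0" using that w_e(2)[of y] by (simp add: sg)
    then have "\<exists>d>0. \<forall>h>0. h < d \<longrightarrow> G (y + (0 + h) *\<^sub>R v) > G (y + 0 *\<^sub>R v)"
      by (rule DERIV_pos_inc_right[OF G_along_ray])
    then have "\<forall>\<^sub>F t in at_right 0. G (y + t *\<^sub>R v) > 0"
      unfolding eventually_at_right_field using G0 by auto
    then show ?thesis
      using eventually_ray_mem_ball[OF y(1), of v]
      by eventually_elim (simp add: mem_domain_iff)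
  qed
qed

lemma outer_normal_eq:
  assumes y: "y \<in> ball x r" "y \<in> frontier \<Omega>"
  shows "outer_normal \<Omega> y = N y"
  unfolding outer_normal_def
proof (rule the_equality)
  fix \<nu> assume \<nu>: "norm \<nu> = 1 \<and>
     (\<forall>v. v \<bullet> \<nu> < 0 \<longrightarrow> (\<forall>\<^sub>F t in at_right 0. y + t *\<^sub>R v \<in> \<Omega>)) \<and>
     (\<forall>v. v \<bullet> \<nu> > 0 \<longrightarrow> (\<forall>\<^sub>F t in at_right 0. y + t *\<^sub>R v \<notin> \<Omega>))"
  show "\<nu> = N y"
  proof (rule ccontr)
    assume "\<nu> \<noteq> N y"
    \<comment> \<open>For distinct unit vectors their difference is obtuse to the one and acute to
      the other, so this ray would both enter and leave the domain.\<close>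
    define v where "v = N y - \<nu>"
    have \<nu>\<nu>: "\<nu> \<bullet> \<nu> = 1" using \<nu> by (simp add: dot_square_norm)
    have "v \<bullet> v > 0" using \<open>\<nu> \<noteq> N y\<close> by (simp add: v_def)
    moreover have comm: "\<nu> \<bullet> N y = N y \<bullet> \<nu>" by (rule inner_commute)
    moreover have "v \<bullet> v = 2 - 2 * (N y \<bullet> \<nu>)"
      unfolding v_def inner_diff_left inner_diff_right \<nu>\<nu> comm N_N by simp
    ultimately have "v \<bullet> \<nu> < 0" "v \<bullet> N y > 0"
      unfolding v_def inner_diff_left \<nu>\<nu> comm N_N by linarith+
    then have "\<forall>\<^sub>F t in at_right 0. y + t *\<^sub>R v \<in> \<Omega>" "\<forall>\<^sub>F t in at_right 0. y + t *\<^sub>R v \<notin> \<Omega>"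
      using \<nu> ray_outside[OF y, of v] by simp_all
    then have "\<forall>\<^sub>F t in at_right (0::real). False"
      by eventually_elim simp
    then show False by simp
  qed
next
  show "norm (N y) = 1 \<and>
     (\<forall>v. v \<bullet> N y < 0 \<longrightarrow> (\<forall>\<^sub>F t in at_right 0. y + t *\<^sub>R v \<in> \<Omega>)) \<and>
     (\<forall>v. v \<bullet> N y > 0 \<longrightarrow> (\<forall>\<^sub>F t in at_right 0. y + t *\<^sub>R v \<notin> \<Omega>))"
    by (intro conjI allI impI norm_N ray_inside[OF y] ray_outside[OF y])
qed

section \<open>Curves in the boundary\<close>

lemma curve_0: "G y = 0 \<Longrightarrow> curve y v 0 = y"
  using P_decomp[of y, symmetric] by (simp add: curve_def G_def)

lemma G_curve [simp]: "G (curve y v t) = 0"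
  by (simp add: G_def curve_def inner_add_left)

lemma has_derivative_graph_along:
  "((\<lambda>t. \<gamma> (P y + t *\<^sub>R P v)) has_derivative (\<lambda>h. (h *\<^sub>R P v) \<bullet> grad \<gamma> (P y + t *\<^sub>R P v))) (at t)"
proof (rule has_derivative_compose[where g=\<gamma>])
  show "((\<lambda>t. P y + t *\<^sub>R P v) has_derivative (\<lambda>h. h *\<^sub>R P v)) (at t)"
    by (auto intro!: derivative_eq_intros)
qed (rule has_derivative_graph)

lemma has_vector_derivative_curve: "(curve y v has_vector_derivative curve' y v t) (at t)"
proof -
  have "(curve y v has_derivative (\<lambda>h. 0 + h *\<^sub>R P v +
      ((h *\<^sub>R P v) \<bullet> grad \<gamma> (P y + t *\<^sub>R P v)) *\<^sub>R e)) (at t)"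
    unfolding curve_def[abs_def]
    by (intro has_derivative_add has_derivative_scaleR_left has_derivative_graph_along
        has_derivative_const has_derivative_ident)
  then show ?thesis
    by (simp add: has_vector_derivative_def curve'_def scaleR_add_right)
qed

text \<open>Orthogonality to \<open>w y\<close> says that the \<open>e\<close>-component of
  \<open>v\<close> is the slope of the graph in the direction \<open>P v\<close>, so lifting
  \<open>P v\<close> to the graph recovers \<open>v\<close>.\<close>

lemma curve'_0: "v \<bullet> N y = 0 \<Longrightarrow> curve' y v 0 = v"
proof -
  assume "v \<bullet> N y = 0"
  then have "v \<bullet> w y = 0" by (simp add: inner_w_eq_0_iff)
  then have "v \<bullet> e = P v \<bullet> grad \<gamma> (P y)"
    by (simp add: w_def inner_diff_right P_adjoint)
  then show ?thesis using P_decomp[of v, symmetric] by (simp add: curve'_def)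
qed

lemma has_vector_derivative_curve':
  "(curve' y v has_vector_derivative (P v \<bullet> (hess \<gamma> (P y) *v P v)) *\<^sub>R e) (at 0)"
proof -
  have "((\<lambda>t. P y + t *\<^sub>R P v) has_derivative (\<lambda>h. h *\<^sub>R P v)) (at 0)"
    by (auto intro!: derivative_eq_intros)
  then have *: "((\<lambda>t. grad \<gamma> (P y + t *\<^sub>R P v)) has_derivative
      (\<lambda>h. hess \<gamma> (P y + 0 *\<^sub>R P v) *v (h *\<^sub>R P v))) (at 0)"
    by (rule has_derivative_compose) (rule has_derivative_grad_graph)
  have "(curve' y v has_derivative
      (\<lambda>h. 0 + (P v \<bullet> (hess \<gamma> (P y + 0 *\<^sub>R P v) *v (h *\<^sub>R P v))) *\<^sub>R e)) (at 0)"
    unfolding curve'_def[abs_def]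
    by (intro has_derivative_add has_derivative_scaleR_left has_derivative_inner_right
        has_derivative_const *)
  then show ?thesis
    by (simp add: has_vector_derivative_def matrix_vector_mult_scaleR)
qed

lemma continuous_curve: "continuous_on UNIV (curve y v)"
  by (intro continuous_at_imp_continuous_on ballI has_vector_derivative_continuous[OF has_vector_derivative_curve])

lemma continuous_curve': "continuous_on UNIV (curve' y v)"
  unfolding curve'_def
  by (intro continuous_intros continuous_on_compose2[OF continuous_grad_graph]) auto

lemma eventually_curve_mem_frontier:
  assumes y: "y \<in> ball x r" "y \<in> frontier \<Omega>"
  shows "\<forall>\<^sub>F t in nhds 0. curve y v t \<in> ball x r \<and> curve y v t \<in> frontier \<Omega>"
proof -
  have "isCont (curve y v) 0"
    using continuous_curve by (simp add: continuous_on_eq_continuous_at)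
  moreover have "curve y v 0 = y" using y mem_frontier_iff curve_0 by blast
  ultimately have "((curve y v) \<longlongrightarrow> y) (nhds 0)"
    unfolding continuous_at tendsto_at_iff_tendsto_nhds by simp
  then have "\<forall>\<^sub>F t in nhds 0. curve y v t \<in> ball x r"
    using y(1) by (auto dest: topological_tendstoD[of _ _ _ "ball x r"])
  then show ?thesis by eventually_elim (simp add: mem_frontier_iff)
qed

lemma x_in_ball: "x \<in> ball x r"
  using r_pos by simp

lemma curve_at_frontier:
  "y \<in> ball x r \<Longrightarrow> y \<in> frontier \<Omega> \<Longrightarrow> curve y v 0 = y"
  using mem_frontier_iff curve_0 by blast

text \<open>Derivatives within the frontier need not be unique, but composing with a boundary curve
  gives ordinary derivatives in one real variable, which are.\<close>

lemma has_vector_derivative_along_curve: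
  assumes y: "y \<in> ball x r" "y \<in> frontier \<Omega>" and v: "v \<bullet> N y = 0"
    and f: "(f has_derivative D) (at y within frontier \<Omega>)"
  shows "((\<lambda>t. f (curve y v t)) has_vector_derivative D v) (at 0)"
proof -
  obtain d where d: "d > 0" "\<And>t. \<bar>t\<bar> < d \<Longrightarrow> curve y v t \<in> frontier \<Omega>"
    using eventually_curve_mem_frontier[OF y, of v] unfolding eventually_nhds_metric
    by (auto simp: dist_real_def)
  let ?I = "{-d<..<d}"
  have "(curve y v has_vector_derivative v) (at 0 within ?I)"
    using has_vector_derivative_curve[of y v 0] curve'_0[OF v]
    by (simp add: has_vector_derivative_at_within)
  moreover have "(f has_derivative D) (at (curve y v 0) within curve y v ` ?I)"
    unfolding curve_at_frontier[OF y]
    by (rule has_derivative_subset[OF f]) (use d in auto)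
  ultimately have "(f \<circ> curve y v has_vector_derivative D v) (at 0 within ?I)"
    by (rule vector_derivative_diff_chain_within)
  moreover have "at 0 within ?I = at (0::real)"
    using d(1) by (intro at_within_open) auto
  ultimately show ?thesis by (simp add: o_def)
qed

section \<open>Gauss map and mean curvature\<close>

lemma has_derivative_outer_normal:
  "(outer_normal \<Omega> has_derivative dN x) (at x within frontier \<Omega>)"
proof (rule has_derivative_transform_within[OF has_derivative_at_withinI[OF has_derivative_N] r_pos frontier_x])
  show "N y = outer_normal \<Omega> y" if "y \<in> frontier \<Omega>" "dist y x < r" for y
    using outer_normal_eq[of y] that by (simp add: dist_commute)
qed

text \<open>\<open>frechet_derivative\<close> selects some derivative within the frontier. It and
  \<open>dN x\<close> are both read off along the same curve, hence agree on tangent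
  vectors.\<close>

lemma frechet_derivative_outer_normal:
  shows "(outer_normal \<Omega> has_derivative frechet_derivative (outer_normal \<Omega>) (at x within frontier \<Omega>))
           (at x within frontier \<Omega>)"
    and "v \<bullet> N x = 0 \<Longrightarrow> frechet_derivative (outer_normal \<Omega>) (at x within frontier \<Omega>) v = dN x v"
proof -
  show *: "(outer_normal \<Omega> has_derivative frechet_derivative (outer_normal \<Omega>) (at x within frontier \<Omega>))
           (at x within frontier \<Omega>)"
    using has_derivative_outer_normal unfolding frechet_derivative_works[symmetric]
    by (auto simp: differentiable_def)
  show "frechet_derivative (outer_normal \<Omega>) (at x within frontier \<Omega>) v = dN x v" if "v \<bullet> N x = 0"
    using vector_derivative_unique_at has_vector_derivative_along_curve[OF x_in_ball frontier_x that]
      * has_derivative_outer_normal by blast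
qed

text \<open>All later arguments reach \<open>H\<close> through this basis: the arbitrary values of
  the chosen derivative off the tangent space have disappeared, and only quadratic form values of
  \<open>dN x\<close> remain.\<close>

lemma mean_curvature_eq:
  assumes n: "CARD('n) \<ge> 2"
  obtains B where "finite B" "pairwise orthogonal B" "\<forall>b\<in>B. norm b = 1"
    "span B = {v. v \<bullet> N x = 0}" "real (card B) = real CARD('n) - 1"
    "(real CARD('n) - 1) * mean_curvature \<Omega> x = (\<Sum>b\<in>B. b \<bullet> dN x b)"
proof -
  let ?S = "{v. v \<bullet> N x = 0}" and ?D = "frechet_derivative (outer_normal \<Omega>) (at x within frontier \<Omega>)"
  have lin: "linear ?D"
    using frechet_derivative_outer_normal(1) by (rule has_derivative_linear)
  have sub: "subspace ?S"
    by (auto simp: subspace_def inner_add_left)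
  have D: "?D v = dN x v" if "v \<in> ?S" for v
    using frechet_derivative_outer_normal(2) that by simp
  have inv: "?D v \<in> ?S" if "v \<in> ?S" for v
    unfolding D[OF that] by (simp add: inner_commute[of _ "N x"])
  have sym: "v \<bullet> ?D w = w \<bullet> ?D v" if "v \<in> ?S" "w \<in> ?S" for v w
    unfolding D[OF that(1)] D[OF that(2)] using that by (simp add: dN_symmetric)
  obtain B where B: "finite B" "pairwise orthogonal B" "span B = ?S" "\<And>b. b \<in> B \<Longrightarrow> norm b = 1"
    and sum: "sum_list (eigenvalue_list ?S ?D) = (\<Sum>b\<in>B. b \<bullet> ?D b)"
    using sum_eigenvalue_list[OF lin sub inv sym] by blast
  have "independent B"
  proof (rule pairwise_orthogonal_independent[OF B(2)])
    show "0 \<notin> B" using B(4)[of 0] by auto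
  qed
  then have "card B = dim (span B)"
    by (rule dim_span_eq_card_independent[symmetric])
  then have "card B = dim ?S"
    unfolding B(3) .
  also have "\<dots> = CARD('n) - 1"
  proof -
    have "N x \<noteq> 0" using norm_N[of x] by (metis norm_zero zero_neq_one)
    then show ?thesis using dim_hyperplane[of "N x"] by (simp add: inner_commute[of _ "N x"])
  qed
  finally have card: "real (card B) = real CARD('n) - 1" using n by simp
  have "B \<subseteq> ?S" using B(3) span_superset by blast
  then have "(\<Sum>b\<in>B. b \<bullet> ?D b) = (\<Sum>b\<in>B. b \<bullet> dN x b)"
    by (intro sum.cong) (auto simp: D)
  then have "(real CARD('n) - 1) * mean_curvature \<Omega> x = (\<Sum>b\<in>B. b \<bullet> dN x b)"
    unfolding mean_curvature_def principal_curvatures_def outer_normal_eq[OF x_in_ball frontier_x] sum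
    using n by simp
  then show thesis using that B card by blast
qed

text \<open>
  No derivative of \<open>f\<close> exists on the boundary itself, so the curve is first pushed into the
  domain by \<open>s *\<^sub>R e\<close> and then \<open>s\<close> tends to \<open>0\<close>.
\<close>

lemma has_vector_derivative_along_curve_closure:
  fixes f :: "real^'n \<Rightarrow> 'b::real_normed_vector"
  assumes y: "y \<in> ball x r" "y \<in> frontier \<Omega>" and v: "v \<bullet> N y = 0"
    and U: "\<rho> > 0" "\<Omega> \<inter> ball y \<rho> \<subseteq> U"
    and f: "continuous_on (closure U) f" "\<And>z. z \<in> U \<Longrightarrow> (f has_derivative F z) (at z)"
    and F: "continuous_on (closure U \<times> UNIV) (\<lambda>(z, h). F z h)" "linear (F y)"
  shows "((\<lambda>t. f (curve y v t)) has_vector_derivative F y v) (at 0)"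
  unfolding has_vector_derivative_def has_derivative_at_alt
proof (intro conjI allI impI)
  show "bounded_linear (\<lambda>t. t *\<^sub>R F y v)" by (rule bounded_linear_scaleR_left)
  fix \<epsilon> :: real assume \<epsilon>: "\<epsilon> > 0"
  let ?c = "curve y v" and ?c' = "curve' y v"
  have c0: "?c 0 = y" using curve_at_frontier[OF y] .
  \<comment> \<open>Continuity jointly in \<open>t\<close> and \<open>s\<close> yields a range of
    \<open>t\<close> that is independent of the push \<open>s\<close>.\<close>
  let ?p = "\<lambda>(t, s). ?c t - s *\<^sub>R e"
  have cont_p: "isCont ?p (0, 0)"
  proof -
    have "continuous_on UNIV ?p"
      unfolding case_prod_unfold
      by (intro continuous_intros continuous_on_compose2[OF continuous_curve]) auto
    then show ?thesis by (simp add: continuous_on_eq_continuous_at)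
  qed
  have cont_q: "isCont (\<lambda>z. (?p z, ?c' (fst z))) (0, 0)"
  proof -
    have "continuous_on UNIV (\<lambda>z. (?p z, ?c' (fst z)))"
      unfolding case_prod_unfold
      by (intro continuous_intros continuous_on_compose2[OF continuous_curve]
          continuous_on_compose2[OF continuous_curve']) auto
    then show ?thesis by (simp add: continuous_on_eq_continuous_at)
  qed
  obtain \<eta>1 where \<eta>1: "\<eta>1 > 0" "\<And>t s. dist (t, s) (0, 0) < \<eta>1 \<Longrightarrow> dist (?c t - s *\<^sub>R e) y < min \<rho> (r - dist x y)"
  proof -
    have "min \<rho> (r - dist x y) > 0" using U y by simp
    then obtain d where "d > 0" and d: "\<And>z. dist z (0, 0) < d \<Longrightarrow> dist (?p z) (?p (0, 0)) < min \<rho> (r - dist x y)"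
      using cont_p unfolding continuous_at_eps_delta by blast
    show thesis
    proof (rule that[OF \<open>d > 0\<close>])
      show "dist (?c t - s *\<^sub>R e) y < min \<rho> (r - dist x y)" if "dist (t, s) (0, 0) < d" for t s
        using d[OF that] c0 by simp
    qed
  qed
  have inside: "?c t - s *\<^sub>R e \<in> ball x r" "?c t - s *\<^sub>R e \<in> ball y \<rho>" if "dist (t, s) (0, 0) < \<eta>1" for t s
    using \<eta>1(2)[OF that] dist_triangle[of x "?c t - s *\<^sub>R e" y] by (auto simp: dist_commute)
  have inU: "?c t - s *\<^sub>R e \<in> U" if "dist (t, s) (0, 0) < \<eta>1" "s > 0" for t s
  proof -
    have "?c t - s *\<^sub>R e \<in> \<Omega>"
      using mem_domain_iff[OF inside(1)[OF that(1)]] G_shift[of "?c t" s] that(2) by simp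
    then show ?thesis using U(2) inside(2)[OF that(1)] by blast
  qed
  have ycl: "?c t \<in> closure U" if "\<bar>t\<bar> < \<eta>1" for t
  proof (rule Lim_in_closed_set[OF closed_closure])
    show "((\<lambda>s. ?c t - s *\<^sub>R e) \<longlongrightarrow> ?c t) (at_right 0)"
      by (auto intro!: tendsto_eq_intros)
    have "((\<lambda>s::real. dist (t, s) (0, 0)) \<longlongrightarrow> dist (t, 0::real) (0, 0)) (at_right 0)"
      by (intro tendsto_intros)
    moreover have "dist (t, 0::real) (0, 0) < \<eta>1" using that by (simp add: dist_Pair_Pair)
    ultimately have "\<forall>\<^sub>F s::real in at_right 0. dist (t, s) (0, 0) < \<eta>1"
      by (rule order_tendstoD(2))
    then show "\<forall>\<^sub>F s in at_right 0. ?c t - s *\<^sub>R e \<in> closure U"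
      using eventually_at_right_less[of 0]
      by eventually_elim (use inU closure_subset in blast)
  qed simp
  have "y \<in> closure U" using ycl[of 0] \<eta>1(1) c0 by simp
  then obtain \<delta> where \<delta>: "\<delta> > 0"
    "\<And>z h. z \<in> closure U \<Longrightarrow> dist (z, h) (y, v) < \<delta> \<Longrightarrow> dist (F z h) (F y v) < \<epsilon>"
  proof -
    obtain d where "d > 0" and d: "\<And>p. p \<in> closure U \<times> UNIV \<Longrightarrow> dist p (y, v) < d \<Longrightarrow>
        dist (case p of (z, h) \<Rightarrow> F z h) (case (y, v) of (z, h) \<Rightarrow> F z h) < \<epsilon>"
      using F(1) \<epsilon> \<open>y \<in> closure U\<close> unfolding continuous_on_iff by blast
    show thesis
    proof (rule that[OF \<open>d > 0\<close>])
      show "dist (F z h) (F y v) < \<epsilon>" if "z \<in> closure U" "dist (z, h) (y, v) < d" for z h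
        using d[of "(z, h)"] that by simp
    qed
  qed
  obtain \<eta>2 where \<eta>2: "\<eta>2 > 0" "\<And>t s. dist (t, s) (0, 0) < \<eta>2 \<Longrightarrow> dist (?c t - s *\<^sub>R e, ?c' t) (y, v) < \<delta>"
  proof -
    obtain d where "d > 0" and d: "\<And>z. dist z (0, 0) < d \<Longrightarrow>
        dist (?p z, ?c' (fst z)) (?p (0, 0), ?c' (fst (0::real, 0::real))) < \<delta>"
      using cont_q \<delta>(1) unfolding continuous_at_eps_delta by blast
    show thesis
    proof (rule that[OF \<open>d > 0\<close>])
      show "dist (?c t - s *\<^sub>R e, ?c' t) (y, v) < \<delta>" if "dist (t, s) (0, 0) < d" for t s
        using d[OF that] c0 curve'_0[OF v] by simp
    qed
  qed
  \<comment> \<open>Halved because the distance of \<open>(t, s)\<close> from the origin is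
    estimated by the sum of absolute values.\<close>
  define \<eta> where "\<eta> = min \<eta>1 \<eta>2 / 2"
  have \<eta>: "\<eta> > 0" using \<eta>1(1) \<eta>2(1) by (simp add: \<eta>_def)
  have small: "dist (t, s) (0, 0) < \<eta>1" "dist (t, s) (0, 0) < \<eta>2" if "\<bar>t\<bar> < \<eta>" "0 \<le> s" "s < \<eta>" for t s
  proof -
    have "dist (t, s) (0, 0) \<le> \<bar>t\<bar> + \<bar>s\<bar>"
      by (simp add: dist_Pair_Pair sqrt_sum_squares_le_sum_abs)
    then show "dist (t, s) (0, 0) < \<eta>1" "dist (t, s) (0, 0) < \<eta>2"
      using that by (auto simp: \<eta>_def)
  qed
  have shifted: "norm (f (?c t - s *\<^sub>R e) - f (?c 0 - s *\<^sub>R e) - t *\<^sub>R F y v) \<le> \<epsilon> * \<bar>t\<bar>"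
    if t: "\<bar>t\<bar> < \<eta>" and s: "0 < s" "s < \<eta>" for t s
  proof -
    \<comment> \<open>Subtracting the expected linear part leaves a function with derivative at most
      \<open>\<epsilon>\<close>; the resulting bound is uniform in \<open>s\<close> and survives the
      limit.\<close>
    define g where "g \<tau> = f (?c \<tau> - s *\<^sub>R e) - \<tau> *\<^sub>R F y v" for \<tau>
    have "norm (g t - g 0) \<le> \<epsilon> * norm (t - 0)"
    proof (rule differentiable_bound[where S="{-\<eta><..<\<eta>}" and
          f'="\<lambda>\<tau> h. h *\<^sub>R (F (?c \<tau> - s *\<^sub>R e) (?c' \<tau>) - F y v)"])
      fix \<tau> assume "\<tau> \<in> {-\<eta><..<\<eta>}"
      then have \<tau>: "\<bar>\<tau>\<bar> < \<eta>" by auto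
      have z: "?c \<tau> - s *\<^sub>R e \<in> U" using inU small(1)[OF \<tau>] s by simp
      have "((\<lambda>\<tau>. ?c \<tau> - s *\<^sub>R e) has_vector_derivative ?c' \<tau>) (at \<tau>)"
        by (auto intro!: derivative_eq_intros has_vector_derivative_curve)
      then have "(f \<circ> (\<lambda>\<tau>. ?c \<tau> - s *\<^sub>R e) has_vector_derivative F (?c \<tau> - s *\<^sub>R e) (?c' \<tau>)) (at \<tau>)"
        using f(2)[OF z] has_derivative_at_withinI by (intro vector_derivative_diff_chain_within) blast+
      then have "(g has_vector_derivative F (?c \<tau> - s *\<^sub>R e) (?c' \<tau>) - F y v) (at \<tau>)"
        unfolding g_def o_def by (auto intro!: derivative_eq_intros)
      then show "(g has_derivative (\<lambda>h. h *\<^sub>R (F (?c \<tau> - s *\<^sub>R e) (?c' \<tau>) - F y v))) (at \<tau> within {-\<eta><..<\<eta>})"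
        by (simp add: has_vector_derivative_def has_derivative_at_withinI)
      have "norm (F (?c \<tau> - s *\<^sub>R e) (?c' \<tau>) - F y v) \<le> \<epsilon>"
        using \<delta>(2)[OF subsetD[OF closure_subset z] \<eta>2(2)[OF small(2)[OF \<tau>]]] s
        by (simp add: dist_norm)
      then show "onorm (\<lambda>h. h *\<^sub>R (F (?c \<tau> - s *\<^sub>R e) (?c' \<tau>) - F y v)) \<le> \<epsilon>"
        by (intro onorm_le) (auto simp: mult.commute[of \<epsilon>] intro!: mult_left_mono)
    qed (use t \<eta> in auto)
    then show ?thesis by (simp add: g_def algebra_simps)
  qed
  show "\<exists>d>0. \<forall>t. norm (t - 0) < d \<longrightarrow>
      norm (f (?c t) - f (?c 0) - (t - 0) *\<^sub>R F y v) \<le> \<epsilon> * norm (t - 0)"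
  proof (intro exI[of _ \<eta>] conjI allI impI \<eta>)
    fix t :: real assume "norm (t - 0) < \<eta>"
    then have t: "\<bar>t\<bar> < \<eta>" by simp
    have lim: "((\<lambda>s. f (?c \<tau> - s *\<^sub>R e)) \<longlongrightarrow> f (?c \<tau>)) (at_right 0)" if "\<bar>\<tau>\<bar> < \<eta>" for \<tau>
    proof (rule continuous_on_tendsto_compose[OF f(1)])
      show "((\<lambda>s. ?c \<tau> - s *\<^sub>R e) \<longlongrightarrow> ?c \<tau>) (at_right 0)"
        by (auto intro!: tendsto_eq_intros)
      show "?c \<tau> \<in> closure U" using ycl[of \<tau>] that \<eta>1(1) \<eta>2(1) by (auto simp: \<eta>_def)
      have "\<forall>\<^sub>F s::real in at_right 0. s < \<eta>" using \<eta> by (rule order_tendstoD(2)[OF tendsto_ident_at])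
      then show "\<forall>\<^sub>F s in at_right 0. ?c \<tau> - s *\<^sub>R e \<in> closure U"
        using eventually_at_right_less[of 0]
        by eventually_elim (use inU small(1)[OF that] closure_subset in \<open>force\<close>)
    qed
    have "((\<lambda>s. norm (f (?c t - s *\<^sub>R e) - f (?c 0 - s *\<^sub>R e) - t *\<^sub>R F y v))
        \<longlongrightarrow> norm (f (?c t) - f (?c 0) - t *\<^sub>R F y v)) (at_right 0)"
      using \<eta> t by (intro tendsto_intros lim) auto
    moreover have "\<forall>\<^sub>F s in at_right 0. norm (f (?c t - s *\<^sub>R e) - f (?c 0 - s *\<^sub>R e) - t *\<^sub>R F y v) \<le> \<epsilon> * \<bar>t\<bar>"
    proof -
      have "\<forall>\<^sub>F s::real in at_right 0. s < \<eta>" using \<eta> by (rule order_tendstoD(2)[OF tendsto_ident_at])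
      then show ?thesis
        using eventually_at_right_less[of 0]
        by eventually_elim (use shifted[OF t] in blast)
    qed
    ultimately show "norm (f (?c t) - f (?c 0) - (t - 0) *\<^sub>R F y v) \<le> \<epsilon> * norm (t - 0)"
      using tendsto_upperbound by fastforce
  qed
qed

section \<open>Critical points of the distance on the boundary\<close>

text \<open>First and second derivative tests for \<open>\<sigma>\<close> times the squared distance
  along a boundary curve; the sign of \<open>\<sigma>\<close> treats farthest and nearest points
  together.\<close>

lemma frontier_extremum_of_distance:
  assumes ext: "\<And>y. y \<in> frontier \<Omega> \<Longrightarrow> \<sigma> * (norm (y - z))\<^sup>2 \<le> \<sigma> * (norm (x - z))\<^sup>2"
    and v: "v \<bullet> N x = 0"
  shows "\<sigma> * ((x - z) \<bullet> v) = 0"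
    and "x - z = \<kappa> *\<^sub>R N x \<Longrightarrow> \<sigma> * (v \<bullet> v) \<le> \<sigma> * \<kappa> * (v \<bullet> dN x v)"
proof -
  let ?c = "curve x v" and ?c' = "curve' x v"
  define \<beta> where "\<beta> = P v \<bullet> (hess \<gamma> (P x) *v P v)"
  define \<phi> where "\<phi> t = \<sigma> * ((?c t - z) \<bullet> (?c t - z))" for t
  define \<phi>' where "\<phi>' t = 2 * \<sigma> * ((?c t - z) \<bullet> ?c' t)" for t
  have c: "((\<lambda>t. ?c t - z) has_derivative (\<lambda>h. h *\<^sub>R ?c' t)) (at t)" for t
    using has_vector_derivative_curve[of x v t]
    by (auto simp: has_vector_derivative_def intro!: derivative_eq_intros)
  have c': "(?c' has_derivative (\<lambda>h. h *\<^sub>R \<beta> *\<^sub>R e)) (at 0)"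
    using has_vector_derivative_curve'[of x v] by (simp add: has_vector_derivative_def \<beta>_def)
  have c0: "?c 0 = x" "?c' 0 = v"
    using curve_at_frontier[OF x_in_ball frontier_x] curve'_0[OF v] by auto
  have d1: "(\<phi> has_real_derivative \<phi>' t) (at t)" for t
    unfolding has_field_derivative_def \<phi>_def \<phi>'_def
    by (rule has_derivative_eq_rhs[OF has_derivative_mult_right[OF has_derivative_inner[OF c c]]])
       (auto simp: fun_eq_iff inner_commute algebra_simps)
  have d2: "(\<phi>' has_real_derivative 2 * \<sigma> * ((x - z) \<bullet> (\<beta> *\<^sub>R e) + v \<bullet> v)) (at 0)"
    unfolding has_field_derivative_def \<phi>'_def
    by (rule has_derivative_eq_rhs[OF has_derivative_mult_right[OF has_derivative_inner[OF c c']]])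
       (auto simp: fun_eq_iff c0 algebra_simps)
  have "\<forall>\<^sub>F t in nhds 0. \<phi> t \<le> \<phi> 0"
    using eventually_curve_mem_frontier[OF x_in_ball frontier_x, of v]
    by eventually_elim (use ext in \<open>auto simp: \<phi>_def c0 power2_norm_eq_inner\<close>)
  then have "\<forall>\<^sub>F t in at 0. \<phi> t \<le> \<phi> 0"
    by (simp add: eventually_at_filter eventually_mono)
  note so = second_derivative_at_local_max[OF d1 d2 this]
  show "\<sigma> * ((x - z) \<bullet> v) = 0"
    using so(1) by (simp add: \<phi>'_def c0)
  assume \<kappa>: "x - z = \<kappa> *\<^sub>R N x"
  \<comment> \<open>The acceleration of the curve is \<open>\<beta> *\<^sub>R e\<close>, not normal,
    but only its component along \<open>N x\<close> counts. The factor \<open>norm (w x)\<close>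
    relating \<open>dw\<close> to \<open>dN\<close> cancels against
    \<open>N x \<bullet> e = 1 / norm (w x)\<close>.\<close>
  have "norm (w x) * (v \<bullet> dN x v) = - \<beta>"
    unfolding dN_tangent[OF v] by (simp add: dw_def \<beta>_def P_adjoint[symmetric])
  then have "\<beta> / norm (w x) = - (v \<bullet> dN x v)"
    using w_e(2)[of x] by (simp add: field_simps)
  moreover have "(x - z) \<bullet> (\<beta> *\<^sub>R e) = \<kappa> * (\<beta> / norm (w x))"
    unfolding \<kappa> by (simp add: N_e)
  ultimately have eq: "(x - z) \<bullet> (\<beta> *\<^sub>R e) = - \<kappa> * (v \<bullet> dN x v)"
    by simp
  show "\<sigma> * (v \<bullet> v) \<le> \<sigma> * \<kappa> * (v \<bullet> dN x v)"
    using so(2) unfolding eq by (simp add: algebra_simps)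
qed

lemma normal_decomposition:
  assumes "\<And>v. v \<bullet> N y = 0 \<Longrightarrow> p \<bullet> v = 0"
  shows "p = (p \<bullet> N y) *\<^sub>R N y"
proof -
  let ?v = "p - (p \<bullet> N y) *\<^sub>R N y"
  have v: "?v \<bullet> N y = 0" by (simp add: inner_diff_left)
  then have "p \<bullet> ?v = 0" by (rule assms)
  then have "?v \<bullet> ?v = 0" using v by (simp add: inner_diff_left inner_diff_right inner_commute)
  then show ?thesis by simp
qed

end

section \<open>Inscribed and circumscribed balls\<close>

text \<open>From a point \<open>y\<close> of the domain outside the ball, the ray from
  \<open>z\<close> continued beyond \<open>y\<close> must leave the bounded domain, and it does so
  at a frontier point even farther from \<open>z\<close>.\<close>

lemma bounded_domain_subset_cball:
  fixes \<Omega> :: "'a::euclidean_space set"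
  assumes "bounded \<Omega>" and fr: "\<And>y. y \<in> frontier \<Omega> \<Longrightarrow> norm (y - z) \<le> R"
  shows "\<Omega> \<subseteq> cball z R"
proof
  fix y assume y: "y \<in> \<Omega>"
  show "y \<in> cball z R"
  proof (rule ccontr)
    assume far: "y \<notin> cball z R"
    \<comment> \<open>Otherwise \<open>R < 0\<close> would make the frontier empty, impossible for a
      nonempty bounded set.\<close>
    have "y \<noteq> z"
    proof
      assume "y = z"
      then have "R < 0" using far by simp
      then have "frontier \<Omega> = {}" using fr by (smt (verit) all_not_in_conv norm_ge_zero)
      moreover have "\<Omega> \<noteq> UNIV" using \<open>bounded \<Omega>\<close> not_bounded_UNIV by blast
      ultimately show False using y frontier_not_empty[of \<Omega>] by blast
    qed
    define c where "c t = z + t *\<^sub>R (y - z)" for t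
    have "connected (c ` {1..})"
      unfolding c_def by (intro connected_continuous_image continuous_intros) auto
    moreover have "c ` {1..} \<inter> \<Omega> \<noteq> {}"
    proof -
      have "c 1 = y" by (simp add: c_def)
      then show ?thesis using y by force
    qed
    moreover have "c ` {1..} - \<Omega> \<noteq> {}"
    proof -
      obtain B where B: "\<And>v. v \<in> \<Omega> \<Longrightarrow> norm (v - z) \<le> B"
        using \<open>bounded \<Omega>\<close> unfolding bounded_any_center[where a=z] by (auto simp: dist_norm norm_minus_commute)
      define t where "t = max 1 ((\<bar>B\<bar> + 1) / norm (y - z))"
      have "norm (c t - z) \<ge> \<bar>B\<bar> + 1"
      proof -
        have "\<bar>B\<bar> + 1 = (\<bar>B\<bar> + 1) / norm (y - z) * norm (y - z)" using \<open>y \<noteq> z\<close> by simp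
        also have "\<dots> \<le> t * norm (y - z)" by (intro mult_right_mono) (auto simp: t_def)
        finally show ?thesis by (simp add: c_def t_def)
      qed
      then have "c t \<notin> \<Omega>" using B[of "c t"] by linarith
      moreover have "t \<in> {1..}" by (simp add: t_def)
      ultimately show ?thesis by blast
    qed
    ultimately obtain t where t: "t \<ge> 1" "c t \<in> frontier \<Omega>"
      using connected_Int_frontier by blast
    have "norm (y - z) \<le> t * norm (y - z)"
      using t(1) by (simp add: mult_le_cancel_right1)
    also have "\<dots> = norm (c t - z)" using t(1) by (simp add: c_def)
    also have "\<dots> \<le> R" using fr t(2) by blast
    finally show False using far by (simp add: dist_norm norm_minus_commute)
  qed
qed

text \<open>The ball is connected and meets the domain at \<open>z\<close>; were it not contained,
  it would meet the frontier.\<close>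

lemma ball_subset_domain:
  fixes \<Omega> :: "'a::euclidean_space set"
  assumes "z \<in> \<Omega>" and fr: "\<And>y. y \<in> frontier \<Omega> \<Longrightarrow> R \<le> norm (y - z)"
  shows "ball z R \<subseteq> \<Omega>"
proof (cases "R > 0")
  case True
  show ?thesis
  proof (rule ccontr)
    assume "\<not> ball z R \<subseteq> \<Omega>"
    then have "ball z R \<inter> frontier \<Omega> \<noteq> {}"
    proof (intro connected_Int_frontier)
      show "ball z R \<inter> \<Omega> \<noteq> {}" using assms(1) True centre_in_ball by blast
    qed auto
    then show False using fr by (force simp: dist_norm norm_minus_commute)
  qed
qed (simp add: ball_empty)

lemma open_eq_ball:
  fixes \<Omega> :: "'a::euclidean_space set"
  assumes "open \<Omega>" "ball z R \<subseteq> \<Omega>" "\<Omega> \<subseteq> cball z R" "R > 0"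
  shows "\<Omega> = ball z R"
  using assms interior_maximal[OF assms(3,1)] by (simp add: interior_cball)

lemma boundary_strip_properties:
  assumes "open \<Omega>" "\<epsilon> > 0"
  shows "open (boundary_strip \<Omega> \<epsilon>)"
    and "y \<in> frontier \<Omega> \<Longrightarrow> \<Omega> \<inter> ball y \<epsilon> \<subseteq> boundary_strip \<Omega> \<epsilon>"
proof -
  have "boundary_strip \<Omega> \<epsilon> = \<Omega> \<inter> {x. infdist x (frontier \<Omega>) < \<epsilon>}"
    by (auto simp: boundary_strip_def)
  then show "open (boundary_strip \<Omega> \<epsilon>)"
    using assms(1) by (auto intro!: open_Int open_Collect_less continuous_intros)
  show "\<Omega> \<inter> ball y \<epsilon> \<subseteq> boundary_strip \<Omega> \<epsilon>" if "y \<in> frontier \<Omega>"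
  proof
    fix z assume "z \<in> \<Omega> \<inter> ball y \<epsilon>"
    then show "z \<in> boundary_strip \<Omega> \<epsilon>"
      using infdist_le[OF that, of z] by (simp add: boundary_strip_def dist_commute)
  qed
qed

lemma continuous_on_matrix_vector_mult_pair:
  fixes A :: "'a::topological_space \<Rightarrow> real^'n^'m"
  assumes "continuous_on S A"
  shows "continuous_on (S \<times> UNIV) (\<lambda>(z, h). A z *v h)"
  unfolding matrix_vector_mult_def case_prod_unfold
  by (intro continuous_intros continuous_on_compose2[OF assms]) auto

lemma has_vector_derivative_transform_eventually:
  assumes "(f has_vector_derivative f') (at x)" "\<forall>\<^sub>F t in nhds x. f t = g t"
  shows "(g has_vector_derivative f') (at x)"
proof -
  obtain S where "open S" "x \<in> S" "\<And>t. t \<in> S \<Longrightarrow> f t = g t"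
    using assms(2) unfolding eventually_nhds by blast
  then show ?thesis
    using assms(1) has_vector_derivative_transform_within_open by blast
qed

section \<open>The boundary values of the equation\<close>

context graph_chart begin

text \<open>\<open>U\<close> stands for the boundary strip, through two properties: it is open and
  it contains the part of the domain near each frontier point.\<close>

context
  fixes U :: "(real^'n) set" and u :: "real^'n \<Rightarrow> real" and Du D2u
  assumes U: "open U" "\<And>y. y \<in> frontier \<Omega> \<Longrightarrow> \<exists>\<rho>>0. \<Omega> \<inter> ball y \<rho> \<subseteq> U"
    and u: "C2_closure u U Du D2u" and u_0: "\<And>y. y \<in> frontier \<Omega> \<Longrightarrow> u y = 0"
begin

text \<open>Along boundary curves \<open>u\<close> is constant. The identity is needed at all
  boundary points of the chart, not just at \<open>x\<close>, because it is differentiated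
  next.\<close>

lemma gradient_normal:
  assumes y: "y \<in> ball x r" "y \<in> frontier \<Omega>"
  shows "Du y = (Du y \<bullet> N y) *\<^sub>R N y"
proof (rule normal_decomposition)
  fix v assume v: "v \<bullet> N y = 0"
  obtain \<rho> where \<rho>: "\<rho> > 0" "\<Omega> \<inter> ball y \<rho> \<subseteq> U" using U(2) y(2) by blast
  have "((\<lambda>t. u (curve y v t)) has_vector_derivative v \<bullet> Du y) (at 0)"
  proof (rule has_vector_derivative_along_curve_closure[OF y v \<rho>, of u "\<lambda>z h. h \<bullet> Du z"])
    show "continuous_on (closure U) u" using u by (simp add: C2_closure_def)
    show "(u has_derivative (\<lambda>h. h \<bullet> Du z)) (at z)" if "z \<in> U" for z
      using u that has_derivative_grad[of u z] by (simp add: C2_closure_def C2_on_def)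
    have "continuous_on (closure U) Du" using u by (simp add: C2_closure_def)
    then show "continuous_on (closure U \<times> UNIV) (\<lambda>(z, h). h \<bullet> Du z)"
      unfolding case_prod_unfold
      by (intro continuous_intros continuous_on_compose2[of "closure U" Du _ fst]) auto
    show "linear (\<lambda>h. h \<bullet> Du y)" by (simp add: linear_iff inner_add_left)
  qed
  moreover have "((\<lambda>t. u (curve y v t)) has_vector_derivative 0) (at 0)"
  proof -
    have "\<forall>\<^sub>F t in nhds 0. 0 = u (curve y v t)"
      using eventually_curve_mem_frontier[OF y, of v] by eventually_elim (simp add: u_0)
    then show ?thesis
      by (rule has_vector_derivative_transform_eventually[OF has_vector_derivative_const])
  qed
  ultimately have "v \<bullet> Du y = 0"
    by (rule vector_derivative_unique_at)
  then show "Du y \<bullet> v = 0"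
    by (simp only: inner_commute)
qed

text \<open>Differentiating \<open>Du = k * N\<close> along a boundary curve gives \<open>k\<close>
  times \<open>dN x v\<close> plus a multiple of \<open>N x\<close>; pairing with the tangent
  \<open>z\<close> removes the latter.\<close>

lemma hessian_tangent:
  assumes v: "v \<bullet> N x = 0" and z: "z \<bullet> N x = 0"
  shows "z \<bullet> (D2u x *v v) = (Du x \<bullet> N x) * (z \<bullet> dN x v)"
proof -
  note x = x_in_ball frontier_x
  obtain \<rho> where \<rho>: "\<rho> > 0" "\<Omega> \<inter> ball x \<rho> \<subseteq> U" using U(2) x(2) by blast
  have Du: "((\<lambda>t. Du (curve x v t)) has_vector_derivative D2u x *v v) (at 0)"
  proof (rule has_vector_derivative_along_curve_closure[OF x v \<rho>, of Du "\<lambda>z h. D2u z *v h"])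
    show "continuous_on (closure U) Du" using u by (simp add: C2_closure_def)
    show "(Du has_derivative (\<lambda>h. D2u y *v h)) (at y)" if "y \<in> U" for y
    proof (rule has_derivative_transform_within_open[OF _ U(1) that])
      show "(grad u has_derivative (\<lambda>h. D2u y *v h)) (at y)"
        using u that has_derivative_hess[of u y] by (simp add: C2_closure_def C2_on_def)
      show "grad u z = Du z" if "z \<in> U" for z
        using u that by (simp add: C2_closure_def)
    qed
    show "continuous_on (closure U \<times> UNIV) (\<lambda>(z, h). D2u z *v h)"
      using u by (intro continuous_on_matrix_vector_mult_pair) (simp add: C2_closure_def)
    show "linear (\<lambda>h. D2u x *v h)" by (rule matrix_vector_mul_linear)
  qed
  have N: "((\<lambda>t. N (curve x v t)) has_vector_derivative dN x v) (at 0)"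
    by (rule has_vector_derivative_along_curve[OF x v has_derivative_at_withinI[OF has_derivative_N]])
  have c0: "curve x v 0 = x" by (rule curve_at_frontier[OF x])
  define k where "k t = Du (curve x v t) \<bullet> N (curve x v t)" for t
  define k' where "k' = Du x \<bullet> dN x v + (D2u x *v v) \<bullet> N x"
  have k: "(k has_real_derivative k') (at 0)"
    using has_derivative_inner[OF Du[unfolded has_vector_derivative_def] N[unfolded has_vector_derivative_def]]
    unfolding k_def[abs_def] k'_def has_field_derivative_def c0
    by (rule has_derivative_eq_rhs) (auto simp: fun_eq_iff algebra_simps)
  have "((\<lambda>t. k t *\<^sub>R N (curve x v t)) has_vector_derivative k 0 *\<^sub>R dN x v + k' *\<^sub>R N (curve x v 0)) (at 0)"
    by (rule has_vector_derivative_scaleR[OF k N])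
  moreover have "\<forall>\<^sub>F t in nhds 0. k t *\<^sub>R N (curve x v t) = Du (curve x v t)"
    using eventually_curve_mem_frontier[OF x, of v]
    by eventually_elim (simp add: k_def gradient_normal[symmetric])
  ultimately have "((\<lambda>t. Du (curve x v t)) has_vector_derivative k 0 *\<^sub>R dN x v + k' *\<^sub>R N x) (at 0)"
    unfolding c0 by (rule has_vector_derivative_transform_eventually)
  then have "D2u x *v v = k 0 *\<^sub>R dN x v + k' *\<^sub>R N x"
    by (rule vector_derivative_unique_at[OF Du])
  then show ?thesis using z by (simp add: inner_add_right k_def c0)
qed

text \<open>In an orthonormal basis completed by \<open>N x\<close>, the normal entry of the trace
  is exactly the term that the operator subtracts, since \<open>Du x\<close> is a nonzero multiple
  of \<open>N x\<close>.\<close>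

lemma normalized_1_laplacian_boundary:
  assumes n: "CARD('n) \<ge> 2" and "Du x \<noteq> 0"
  shows "normalized_1_laplacian (Du x) (D2u x)
    = (Du x \<bullet> outer_normal \<Omega> x) * ((real CARD('n) - 1) * mean_curvature \<Omega> x)"
proof -
  note x = x_in_ball frontier_x
  obtain B where B: "finite B" "pairwise orthogonal B" "\<forall>b\<in>B. norm b = 1"
    "span B = {v. v \<bullet> N x = 0}" "real (card B) = real CARD('n) - 1"
    "(real CARD('n) - 1) * mean_curvature \<Omega> x = (\<Sum>b\<in>B. b \<bullet> dN x b)"
    by (rule mean_curvature_eq[OF n])
  have BN: "b \<bullet> N x = 0" if "b \<in> B" for b
    using B(4) span_base[OF that] by blast
  define k where "k = Du x \<bullet> N x"
  have Du: "Du x = k *\<^sub>R N x" unfolding k_def by (rule gradient_normal[OF x])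
  then have k: "k \<noteq> 0" using assms by auto
  have notin: "N x \<notin> B" using BN[of "N x"] by auto
  have "span (insert (N x) B) = UNIV"
  proof -
    have "v \<in> span (insert (N x) B)" for v
    proof -
      have "v - (v \<bullet> N x) *\<^sub>R N x \<in> span B"
        unfolding B(4) by (simp add: inner_diff_left)
      then show ?thesis using span_breakdown_eq by blast
    qed
    then show ?thesis by blast
  qed
  moreover have "pairwise orthogonal (insert (N x) B)"
    using B(2) BN by (auto simp: pairwise_insert orthogonal_def inner_commute[of "N x"])
  ultimately have "trace (D2u x) = (\<Sum>b\<in>insert (N x) B. b \<bullet> (D2u x *v b))"
    using B(1,3) by (intro trace_orthonormal_basis) auto
  also have "\<dots> = N x \<bullet> (D2u x *v N x) + (\<Sum>b\<in>B. b \<bullet> (D2u x *v b))"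
    using B(1) notin by simp
  also have "(\<Sum>b\<in>B. b \<bullet> (D2u x *v b)) = (\<Sum>b\<in>B. k * (b \<bullet> dN x b))"
    using BN hessian_tangent by (intro sum.cong) (auto simp: k_def)
  also have "\<dots> = k * ((real CARD('n) - 1) * mean_curvature \<Omega> x)"
    by (simp add: B(6) sum_distrib_left)
  also have "N x \<bullet> (D2u x *v N x) = ((D2u x *v Du x) \<bullet> Du x) / (norm (Du x))\<^sup>2"
    using k by (simp add: Du matrix_vector_mult_scaleR inner_commute power_mult_distrib power2_eq_square)
  finally show ?thesis
    unfolding normalized_1_laplacian_def outer_normal_eq[OF x] k_def by simp
qed

end

text \<open>The second-order inequality is summed over an orthonormal tangent basis and divided by
  the number \<open>n - 1\<close> of its elements.\<close>

lemma
  assumes n: "CARD('n) \<ge> 2" and \<sigma>: "\<sigma> \<noteq> 0"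
    and ext: "\<And>y. y \<in> frontier \<Omega> \<Longrightarrow> \<sigma> * (norm (y - z))\<^sup>2 \<le> \<sigma> * (norm (x - z))\<^sup>2"
  shows normal_at_extremum: "x - z = ((x - z) \<bullet> N x) *\<^sub>R N x"
    and mean_curvature_at_extremum: "\<sigma> \<le> \<sigma> * ((x - z) \<bullet> N x) * mean_curvature \<Omega> x"
proof -
  show eq: "x - z = ((x - z) \<bullet> N x) *\<^sub>R N x"
    using frontier_extremum_of_distance(1)[OF ext] \<sigma> by (intro normal_decomposition) simp
  obtain B where "finite B" "pairwise orthogonal B" and B: "\<forall>b\<in>B. norm b = 1"
    "span B = {v. v \<bullet> N x = 0}" "real (card B) = real CARD('n) - 1"
    "(real CARD('n) - 1) * mean_curvature \<Omega> x = (\<Sum>b\<in>B. b \<bullet> dN x b)"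
    by (rule mean_curvature_eq[OF n])
  let ?\<kappa> = "(x - z) \<bullet> N x"
  have "\<sigma> \<le> \<sigma> * ?\<kappa> * (b \<bullet> dN x b)" if b: "b \<in> B" for b
  proof -
    have "b \<bullet> N x = 0" using B(2) span_base[OF b] by blast
    from frontier_extremum_of_distance(2)[OF ext this eq] show ?thesis
      using B(1) b by (simp add: dot_square_norm)
  qed
  then have "(\<Sum>b\<in>B. \<sigma>) \<le> (\<Sum>b\<in>B. \<sigma> * ?\<kappa> * (b \<bullet> dN x b))"
    by (rule sum_mono)
  then have "real (card B) * \<sigma> \<le> \<sigma> * ?\<kappa> * (\<Sum>b\<in>B. b \<bullet> dN x b)"
    by (simp add: sum_distrib_left)
  also have "\<dots> = real (card B) * (\<sigma> * ?\<kappa> * mean_curvature \<Omega> x)"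
    by (simp flip: B(4) add: B(3))
  finally show "\<sigma> \<le> \<sigma> * ?\<kappa> * mean_curvature \<Omega> x"
    using B(3) n by simp
qed

text \<open>Criticality leaves only a sign open in \<open>x - z = \<plusminus>R * N\<close>. With
  the minus sign, moving away from \<open>z\<close> would enter the domain outside the circumscribed
  ball.\<close>

lemma mean_curvature_farthest:
  assumes n: "CARD('n) \<ge> 2" and "bounded \<Omega>" and "R > 0" and R: "norm (x - z) = R"
    and far: "\<And>y. y \<in> frontier \<Omega> \<Longrightarrow> norm (y - z) \<le> R"
  shows "1 \<le> R * mean_curvature \<Omega> x"
proof -
  let ?\<kappa> = "(x - z) \<bullet> N x"
  have ext: "1 * (norm (y - z))\<^sup>2 \<le> 1 * (norm (x - z))\<^sup>2" if "y \<in> frontier \<Omega>" for y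
    using far[OF that] R by (simp add: power_mono)
  have eq: "x - z = ?\<kappa> *\<^sub>R N x" using normal_at_extremum[OF n _ ext] by simp
  then have "\<bar>?\<kappa>\<bar> = R" using R norm_N[of x] by (metis norm_scaleR mult.right_neutral)
  moreover have "\<not> ?\<kappa> < 0"
  proof
    assume "?\<kappa> < 0"
    then have "\<forall>\<^sub>F t in at_right 0. x + t *\<^sub>R (x - z) \<in> \<Omega>"
      by (rule ray_inside[OF x_in_ball frontier_x])
    then have "\<forall>\<^sub>F t in at_right 0. 0 < t \<and> x + t *\<^sub>R (x - z) \<in> \<Omega>"
      using eventually_at_right_less[of 0] by eventually_elim simp
    then obtain t :: real where t: "t > 0" "x + t *\<^sub>R (x - z) \<in> \<Omega>"
      using eventually_happens trivial_limit_at_right_real by blast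
    have "x + t *\<^sub>R (x - z) \<in> cball z R"
      using bounded_domain_subset_cball[OF \<open>bounded \<Omega>\<close> far] t by blast
    moreover have "x + t *\<^sub>R (x - z) - z = (1 + t) *\<^sub>R (x - z)" by (simp add: algebra_simps)
    then have "norm (x + t *\<^sub>R (x - z) - z) = (1 + t) * R" using t R by simp
    ultimately show False using t \<open>R > 0\<close> by (simp add: dist_norm norm_minus_commute)
  qed
  ultimately have "?\<kappa> = R" by linarith
  then show ?thesis using mean_curvature_at_extremum[OF n _ ext] by simp
qed

text \<open>The sign is settled as for the farthest point: with the minus sign, moving towards
  \<open>z\<close> would leave the domain inside the inscribed ball.\<close>

lemma mean_curvature_nearest:
  assumes n: "CARD('n) \<ge> 2" and "z \<in> \<Omega>" and "R > 0" and R: "norm (x - z) = R"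
    and near: "\<And>y. y \<in> frontier \<Omega> \<Longrightarrow> R \<le> norm (y - z)"
  shows "R * mean_curvature \<Omega> x \<le> 1"
proof -
  let ?\<kappa> = "(x - z) \<bullet> N x"
  have ext: "(-1) * (norm (y - z))\<^sup>2 \<le> (-1) * (norm (x - z))\<^sup>2" if "y \<in> frontier \<Omega>" for y
    using near[OF that] R \<open>R > 0\<close> by (simp add: power_mono)
  have eq: "x - z = ?\<kappa> *\<^sub>R N x" using normal_at_extremum[OF n _ ext] by simp
  then have "\<bar>?\<kappa>\<bar> = R" using R norm_N[of x] by (metis norm_scaleR mult.right_neutral)
  moreover have "\<not> ?\<kappa> < 0"
  proof
    assume "?\<kappa> < 0"
    then have "- (x - z) \<bullet> N x > 0" by (simp only: inner_minus_left neg_0_less_iff_less)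
    then have "\<forall>\<^sub>F t in at_right 0. x + t *\<^sub>R (- (x - z)) \<notin> \<Omega>"
      by (rule ray_outside[OF x_in_ball frontier_x])
    moreover have "\<forall>\<^sub>F t in at_right (0::real). t < 1"
      by (rule order_tendstoD(2)[OF tendsto_ident_at]) simp
    ultimately have "\<forall>\<^sub>F t in at_right 0. 0 < t \<and> t < 1 \<and> x + t *\<^sub>R (- (x - z)) \<notin> \<Omega>"
      using eventually_at_right_less[of 0] by eventually_elim simp
    then obtain t :: real where t: "t > 0" "t < 1" "x + t *\<^sub>R (- (x - z)) \<notin> \<Omega>"
      using eventually_happens trivial_limit_at_right_real by blast
    have "x + t *\<^sub>R (- (x - z)) - z = (1 - t) *\<^sub>R (x - z)" by (simp add: algebra_simps)
    then have "norm (x + t *\<^sub>R (- (x - z)) - z) = (1 - t) * R" using t R by simp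
    also have "\<dots> < R" using t \<open>R > 0\<close> by simp
    finally have "x + t *\<^sub>R (- (x - z)) \<in> ball z R" by (simp add: dist_norm norm_minus_commute)
    then show False using ball_subset_domain[OF \<open>z \<in> \<Omega>\<close> near] t by blast
  qed
  ultimately have "?\<kappa> = R" by linarith
  then show ?thesis using mean_curvature_at_extremum[OF n _ ext] by simp
qed

end

lemma C2_boundary_chart:
  assumes "open \<Omega>" "C2_boundary \<Omega>" "x \<in> frontier \<Omega>"
  obtains e r \<gamma> where "graph_chart \<Omega> x e r \<gamma>"
proof -
  obtain r e \<gamma> where "r > 0" "norm e = 1" "C2_on \<gamma> UNIV"
    "\<Omega> \<inter> ball x r = {y \<in> ball x r. y \<bullet> e < \<gamma> (y - (y \<bullet> e) *\<^sub>R e)}"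
    using assms(2,3) unfolding C2_boundary_def by (elim ballE exE conjE) auto
  then show thesis
    using assms(1,3) by (intro that graph_chart.intro)
qed

section \<open>The overdetermined problem\<close>

theorem theorem1p3:
  fixes \<Omega> :: "(real^'n) set" and xbar :: "real^'n"
    and q :: "real \<Rightarrow> real \<Rightarrow> real" and R1 R2 :: real
  assumes "CARD('n) \<ge> 2"
    and "open \<Omega>" and "bounded \<Omega>" and "C2_boundary \<Omega>"
    and "xbar \<in> \<Omega>"
    and "R1 = (INF x\<in>frontier \<Omega>. norm (x - xbar))"
    and "R2 = (SUP x\<in>frontier \<Omega>. norm (x - xbar))"
    and "\<And>r h. r \<in> {R1..R2} \<Longrightarrow> h > 0 \<Longrightarrow> q r h > 0"
    and "\<And>r. r \<in> {R1..R2} \<Longrightarrow> mono_on {0<..} (q r)"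
    and "strict_mono_on {R1..R2} (\<lambda>r. q r (1 / r) / r)"
    and "\<exists>u. solution_smooth_near_boundary \<Omega> xbar q u"
  shows "R1 = R2 \<and> \<Omega> = ball xbar R1"
proof -
  let ?H = "mean_curvature \<Omega>" and ?n = "real CARD('n) - 1"
  have n: "?n > 0" using assms(1) by simp
  have compact: "compact (frontier \<Omega>)"
    using assms(3) by (rule compact_frontier_bounded)
  have nonempty: "frontier \<Omega> \<noteq> {}"
    using assms(3,5) not_bounded_UNIV frontier_not_empty[of \<Omega>] by blast
  have cont: "continuous_on (frontier \<Omega>) (\<lambda>x. norm (x - xbar))"
    by (intro continuous_intros)
  obtain x1 where x1: "x1 \<in> frontier \<Omega>" "\<And>y. y \<in> frontier \<Omega> \<Longrightarrow> norm (x1 - xbar) \<le> norm (y - xbar)"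
    using continuous_attains_inf[OF compact nonempty cont] by blast
  obtain x2 where x2: "x2 \<in> frontier \<Omega>" "\<And>y. y \<in> frontier \<Omega> \<Longrightarrow> norm (y - xbar) \<le> norm (x2 - xbar)"
    using continuous_attains_sup[OF compact nonempty cont] by blast
  have R1: "norm (x1 - xbar) = R1"
    unfolding assms(6) using x1 by (intro cInf_eq_minimum[symmetric]) auto
  have R2: "norm (x2 - xbar) = R2"
    unfolding assms(7) using x2 by (intro cSup_eq_maximum[symmetric]) auto
  have "x1 \<noteq> xbar"
    using x1(1) assms(2,5) by (auto simp: frontier_def interior_open)
  then have pos: "R1 > 0" using R1 by auto
  have le: "R1 \<le> R2" using x1(2)[OF x2(1)] R1 R2 by simp

  obtain u where viscosity: "viscosity_solution \<Omega> xbar q u"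
    and smooth: "\<exists>\<epsilon>>0. \<exists>Du D2u.
        C2_closure u (boundary_strip \<Omega> \<epsilon>) Du D2u \<and>
        (\<forall>x\<in>closure (boundary_strip \<Omega> \<epsilon>).
           Du x \<noteq> 0 \<and> - normalized_1_laplacian (Du x) (D2u x) = 1) \<and>
        (\<forall>x\<in>frontier \<Omega>. u x = 0 \<and>
           - (Du x \<bullet> outer_normal \<Omega> x) = q (norm (x - xbar)) (mean_curvature \<Omega> x))"
    using assms(11) unfolding solution_smooth_near_boundary_def by blast
  have H_pos: "?H x > 0" if "x \<in> frontier \<Omega>" for x
    using viscosity that unfolding viscosity_solution_def by blast
  have key: "q (norm (x - xbar)) (?H x) * (?n * ?H x) = 1" if x: "x \<in> frontier \<Omega>" for x
  proof -
    obtain e r \<gamma> where "graph_chart \<Omega> x e r \<gamma>"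
      using C2_boundary_chart[OF assms(2,4) x] .
    then interpret graph_chart \<Omega> x e r \<gamma> .
    obtain \<epsilon> Du D2u where \<epsilon>: "\<epsilon> > 0"
      and C2: "C2_closure u (boundary_strip \<Omega> \<epsilon>) Du D2u"
      and pde: "\<And>x. x \<in> closure (boundary_strip \<Omega> \<epsilon>) \<Longrightarrow>
           Du x \<noteq> 0 \<and> - normalized_1_laplacian (Du x) (D2u x) = 1"
      and bc: "\<And>x. x \<in> frontier \<Omega> \<Longrightarrow> u x = 0 \<and>
           - (Du x \<bullet> outer_normal \<Omega> x) = q (norm (x - xbar)) (mean_curvature \<Omega> x)"
      using smooth by blast
    have strip: "\<exists>\<rho>>0. \<Omega> \<inter> ball y \<rho> \<subseteq> boundary_strip \<Omega> \<epsilon>" if "y \<in> frontier \<Omega>" for y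
      using boundary_strip_properties(2)[OF assms(2) \<epsilon> that] \<epsilon> by blast
    \<comment> \<open>The equation holds up to the closure of the strip, so it may be evaluated at
      the boundary point itself.\<close>
    have "x \<in> closure (boundary_strip \<Omega> \<epsilon>)"
    proof -
      have "x \<in> closure (\<Omega> \<inter> ball x \<epsilon>)"
        using x \<epsilon> open_Int_closure_subset[of "ball x \<epsilon>" \<Omega>]
        by (auto simp: frontier_def Int_commute)
      then show ?thesis
        using closure_mono[OF boundary_strip_properties(2)[OF assms(2) \<epsilon> x]] by blast
    qed
    from pde[OF this] have "Du x \<noteq> 0" "normalized_1_laplacian (Du x) (D2u x) = - 1" by linarith+
    moreover from bc have u0: "\<And>y. y \<in> frontier \<Omega> \<Longrightarrow> u y = 0" by blast
    ultimately have "(Du x \<bullet> outer_normal \<Omega> x) * (?n * ?H x) = - 1"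
      using normalized_1_laplacian_boundary
        [OF boundary_strip_properties(1)[OF assms(2) \<epsilon>] strip C2 u0 assms(1)] by simp
    moreover have "q (norm (x - xbar)) (?H x) = - (Du x \<bullet> outer_normal \<Omega> x)"
      using bc[OF x] by simp
    ultimately show ?thesis by simp
  qed
  have H1: "R1 * ?H x1 \<le> 1"
  proof -
    obtain e r \<gamma> where "graph_chart \<Omega> x1 e r \<gamma>"
      using C2_boundary_chart[OF assms(2,4) x1(1)] .
    then interpret graph_chart \<Omega> x1 e r \<gamma> .
    show ?thesis
      using mean_curvature_nearest[OF assms(1,5) pos R1] x1(2) R1 by simp
  qed
  have H2: "1 \<le> R2 * ?H x2"
  proof -
    obtain e r \<gamma> where "graph_chart \<Omega> x2 e r \<gamma>"
      using C2_boundary_chart[OF assms(2,4) x2(1)] .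
    then interpret graph_chart \<Omega> x2 e r \<gamma> .
    show ?thesis
      using mean_curvature_farthest[OF assms(1,3) _ R2] x2(2) R2 pos le by simp
  qed

  have q1: "q R1 (1 / R1) / R1 \<ge> 1 / ?n"
  proof -
    have "?H x1 \<le> 1 / R1" using H1 pos by (simp add: field_simps)
    then have "q R1 (?H x1) \<le> q R1 (1 / R1)"
      using assms(9)[of R1] le pos H_pos[OF x1(1)] by (auto elim!: mono_onD)
    moreover have "q R1 (?H x1) \<ge> R1 / ?n"
    proof -
      \<comment> \<open>\<open>key\<close> replaces \<open>1 / (n - 1)\<close> by
        \<open>H * q\<close>; the remaining factor \<open>R1 * H\<close> is at most 1.\<close>
      have "R1 / ?n = (R1 * ?H x1) * q R1 (?H x1)"
        using key[OF x1(1)] n unfolding R1 by (simp add: field_simps)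
      also have "\<dots> \<le> 1 * q R1 (?H x1)"
        using H1 assms(8)[of R1 "?H x1"] le H_pos[OF x1(1)] by (intro mult_right_mono) auto
      finally show ?thesis by simp
    qed
    ultimately have "R1 / ?n \<le> q R1 (1 / R1)" by linarith
    then show ?thesis using pos by (simp add: field_simps)
  qed
  have q2: "q R2 (1 / R2) / R2 \<le> 1 / ?n"
  proof -
    have pos2: "R2 > 0" using pos le by simp
    have "1 / R2 \<le> ?H x2" using H2 pos2 by (simp add: field_simps)
    then have "q R2 (1 / R2) \<le> q R2 (?H x2)"
      using assms(9)[of R2] le pos2 H_pos[OF x2(1)] by (auto elim!: mono_onD)
    moreover have "q R2 (?H x2) \<le> R2 / ?n"
    proof -
      have "1 * q R2 (?H x2) \<le> (R2 * ?H x2) * q R2 (?H x2)"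
        using H2 assms(8)[of R2 "?H x2"] le H_pos[OF x2(1)] by (intro mult_right_mono) auto
      also have "\<dots> = R2 / ?n"
        using key[OF x2(1)] n unfolding R2 by (simp add: field_simps)
      finally show ?thesis by simp
    qed
    ultimately have "q R2 (1 / R2) \<le> R2 / ?n" by linarith
    then show ?thesis using pos2 by (simp add: field_simps)
  qed
  have "\<not> R1 < R2"
  proof
    assume "R1 < R2"
    then have "q R1 (1 / R1) / R1 < q R2 (1 / R2) / R2"
      using assms(10) by (auto elim!: strict_mono_onD)
    then show False using q1 q2 by linarith
  qed
  then have eq: "R1 = R2" using le by simp
  moreover have "\<Omega> = ball xbar R1"
  proof (rule open_eq_ball[OF assms(2) _ _ pos])
    show "ball xbar R1 \<subseteq> \<Omega>"
      using ball_subset_domain[OF assms(5)] x1(2) R1 by blast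
    show "\<Omega> \<subseteq> cball xbar R1"
      using bounded_domain_subset_cball[OF assms(3)] x2(2) R2 eq by blast
  qed
  ultimately show ?thesis by blast
qed

end
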